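(* Let $T$ be a finite irreducible rooted tree (i.e., no node of $T$ has exactly one child). Then $T$ is an IR-tree if and only if $T$ has no node that has exactly two children of which exactly one is a leaf.
   Context: Graphs are finite and undirected. A coloring of a graph $G=(V,E)$ is a surjective map $\pi\colon V\to\{1,\dots,k\}$; its cells are the sets $\pi^{-1}(i)$; it is discrete if all cells are singletons. A coloring $\pi$ is finer than $\pi'$ if $\pi(v)=\pi(v')$ implies $\pi'(v)=\pi'(v')$. A coloring is equitable if for all colors $i,j$ all $i$-colored vertices have the same number of $j$-colored neighbors. For a colored graph $(G,\pi)$ and a sequence $\nu$ of vertices, $\mathrm{Ref}(G,\pi,\nu)$ denotes the (unique up to renaming of colors, computed isomorphism-invariantly) coarsest equitable coloring finer than $\pi$ in which every vertex of $\nu$ forms a singleton cell, where the $i$-th vertex of $\nu$ receives the $i$-th of a set of special "individualization" colors distinct from all other colors (this is the result of individualization followed by color refinement). A cell selector is a function $\mathrm{Sel}$ mapping a graph $G$ with coloring $\pi$ to a set of vertices such that: $\mathrm{Sel}(G^\varphi,\pi^\varphi)=\mathrm{Sel}(G,\pi)^\varphi$ for every permutation $\varphi$ of the vertices; if $\pi$ is discrete then $\mathrm{Sel}(G,\pi)=\emptyset$; if $\pi$ is not discrete then $\mathrm{Sel}(G,\pi)$ is a cell of $\pi$ of size greater than $1$. The IR-tree $\Gamma_{\mathrm{Sel}}(G,\pi)$ is the rooted tree whose nodes are sequences of vertices of $G$: the root is the empty sequence $\epsilon$, and the children of a node $\nu$ are the sequences $\nu.v$ for $v\in \mathrm{Sel}(G,\mathrm{Ref}(G,\pi,\nu))$.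 A rooted tree $T$ is called an IR-tree if there exist a colored graph $(G,\pi)$ and a cell selector $\mathrm{Sel}$ such that $\Gamma_{\mathrm{Sel}}(G,\pi)$ is isomorphic to $T$ as a rooted tree. *)

theory Defs
  imports "HOL-Combinatorics.Permutations"
begin

text \<open>A finite rooted tree on a node set V with root r, given by a parent map par
  (only relevant on V - {r}); every node reaches the root by iterating par.\<close>

definition rooted_tree :: "'a set \<Rightarrow> 'a \<Rightarrow> ('a \<Rightarrow> 'a) \<Rightarrow> bool" where
  "rooted_tree V r par \<longleftrightarrow> finite V \<and> r \<in> V \<and>
     (\<forall>v \<in> V - {r}. par v \<in> V) \<and> (\<forall>v \<in> V. \<exists>k. (par ^^ k) v = r)"

definition children :: "'a set \<Rightarrow> 'a \<Rightarrow> ('a \<Rightarrow> 'a) \<Rightarrow> 'a \<Rightarrow> 'a set" where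
  "children V r par u = {v \<in> V. v \<noteq> r \<and> par v = u}"

definition is_leaf :: "'a set \<Rightarrow> 'a \<Rightarrow> ('a \<Rightarrow> 'a) \<Rightarrow> 'a \<Rightarrow> bool" where
  "is_leaf V r par u \<longleftrightarrow> children V r par u = {}"

definition irreducible_tree :: "'a set \<Rightarrow> 'a \<Rightarrow> ('a \<Rightarrow> 'a) \<Rightarrow> bool" where
  "irreducible_tree V r par \<longleftrightarrow> (\<forall>u \<in> V. card (children V r par u) \<noteq> 1)"

definition rooted_tree_iso ::
  "'a set \<Rightarrow> 'a \<Rightarrow> ('a \<Rightarrow> 'a) \<Rightarrow> 'b set \<Rightarrow> 'b \<Rightarrow> ('b \<Rightarrow> 'b) \<Rightarrow> bool" where
  "rooted_tree_iso V1 r1 par1 V2 r2 par2 \<longleftrightarrow>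
     (\<exists>f. bij_betw f V1 V2 \<and> f r1 = r2 \<and> (\<forall>v \<in> V1 - {r1}. par2 (f v) = f (par1 v)))"

definition is_graph :: "nat \<Rightarrow> (nat \<Rightarrow> nat \<Rightarrow> bool) \<Rightarrow> bool" where
  "is_graph n E \<longleftrightarrow> (\<forall>x y. E x y \<longrightarrow> x < n \<and> y < n \<and> x \<noteq> y \<and> E y x)"

definition is_coloring :: "nat \<Rightarrow> (nat \<Rightarrow> nat) \<Rightarrow> bool" where
  "is_coloring n \<pi> \<longleftrightarrow> (\<exists>k. \<pi> ` {..<n} = {1..k}) \<and> (\<forall>v. n \<le> v \<longrightarrow> \<pi> v = 0)"

definition discrete :: "nat \<Rightarrow> (nat \<Rightarrow> nat) \<Rightarrow> bool" where
  "discrete n \<pi> \<longleftrightarrow> inj_on \<pi> {..<n}"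

definition finer :: "nat \<Rightarrow> (nat \<Rightarrow> nat) \<Rightarrow> (nat \<Rightarrow> nat) \<Rightarrow> bool" where
  "finer n \<rho> \<pi> \<longleftrightarrow> (\<forall>v<n. \<forall>w<n. \<rho> v = \<rho> w \<longrightarrow> \<pi> v = \<pi> w)"

definition equitable :: "nat \<Rightarrow> (nat \<Rightarrow> nat \<Rightarrow> bool) \<Rightarrow> (nat \<Rightarrow> nat) \<Rightarrow> bool" where
  "equitable n E \<rho> \<longleftrightarrow> (\<forall>v<n. \<forall>w<n. \<rho> v = \<rho> w \<longrightarrow>
      (\<forall>c. card {u. u < n \<and> E v u \<and> \<rho> u = c} = card {u. u < n \<and> E w u \<and> \<rho> u = c}))"

definition cells :: "nat \<Rightarrow> (nat \<Rightarrow> nat) \<Rightarrow> nat set set" where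
  "cells n \<pi> = {{v. v < n \<and> \<pi> v = c} | c. c \<in> \<pi> ` {..<n}}"

definition perm_graph :: "(nat \<Rightarrow> nat) \<Rightarrow> (nat \<Rightarrow> nat \<Rightarrow> bool) \<Rightarrow> (nat \<Rightarrow> nat \<Rightarrow> bool)" where
  "perm_graph \<phi> E = (\<lambda>x y. E (inv \<phi> x) (inv \<phi> y))"

definition perm_coloring :: "(nat \<Rightarrow> nat) \<Rightarrow> (nat \<Rightarrow> nat) \<Rightarrow> (nat \<Rightarrow> nat)" where
  "perm_coloring \<phi> \<pi> = \<pi> \<circ> inv \<phi>"

definition refinement_spec ::
  "nat \<Rightarrow> ((nat \<Rightarrow> nat \<Rightarrow> bool) \<Rightarrow> (nat \<Rightarrow> nat) \<Rightarrow> nat list \<Rightarrow> (nat \<Rightarrow> nat)) \<Rightarrow> bool" where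
  "refinement_spec n R \<longleftrightarrow>
    (\<forall>E \<pi> \<nu>. is_graph n E \<and> is_coloring n \<pi> \<and> distinct \<nu> \<and> set \<nu> \<subseteq> {..<n} \<longrightarrow>
       is_coloring n (R E \<pi> \<nu>) \<and> equitable n E (R E \<pi> \<nu>) \<and> finer n (R E \<pi> \<nu>) \<pi> \<and>
       (\<forall>i < length \<nu>. R E \<pi> \<nu> (\<nu> ! i) = Suc i) \<and>
       (\<forall>v<n. v \<notin> set \<nu> \<longrightarrow> length \<nu> < R E \<pi> \<nu> v) \<and>
       (\<forall>\<sigma>. is_coloring n \<sigma> \<and> equitable n E \<sigma> \<and> finer n \<sigma> \<pi> \<and>
            (\<forall>v \<in> set \<nu>. \<forall>w<n. \<sigma> w = \<sigma> v \<longrightarrow> w = v) \<longrightarrow> finer n \<sigma> (R E \<pi> \<nu>)) \<and>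
       (\<forall>\<phi>. \<phi> permutes {..<n} \<longrightarrow>
          R (perm_graph \<phi> E) (perm_coloring \<phi> \<pi>) (map \<phi> \<nu>) = perm_coloring \<phi> (R E \<pi> \<nu>)))"

definition refinement ::
  "(nat \<Rightarrow> (nat \<Rightarrow> nat \<Rightarrow> bool) \<Rightarrow> (nat \<Rightarrow> nat) \<Rightarrow> nat list \<Rightarrow> (nat \<Rightarrow> nat)) \<Rightarrow> bool" where
  "refinement Ref \<longleftrightarrow> (\<forall>n. refinement_spec n (Ref n))"

definition cell_selector ::
  "nat \<Rightarrow> ((nat \<Rightarrow> nat \<Rightarrow> bool) \<Rightarrow> (nat \<Rightarrow> nat) \<Rightarrow> nat set) \<Rightarrow> bool" where
  "cell_selector n Sel \<longleftrightarrow>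
    (\<forall>E \<pi>. is_graph n E \<and> is_coloring n \<pi> \<longrightarrow>
       (\<forall>\<phi>. \<phi> permutes {..<n} \<longrightarrow>
          Sel (perm_graph \<phi> E) (perm_coloring \<phi> \<pi>) = \<phi> ` Sel E \<pi>) \<and>
       (discrete n \<pi> \<longrightarrow> Sel E \<pi> = {}) \<and>
       (\<not> discrete n \<pi> \<longrightarrow> Sel E \<pi> \<in> cells n \<pi> \<and> card (Sel E \<pi>) > 1))"

text \<open>Nodes of the IR-tree \<Gamma>_Sel(G,\<pi>); root [] and parent map butlast.\<close>

inductive_set ir_nodes ::
  "((nat \<Rightarrow> nat \<Rightarrow> bool) \<Rightarrow> (nat \<Rightarrow> nat) \<Rightarrow> nat list \<Rightarrow> (nat \<Rightarrow> nat)) \<Rightarrow>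
   ((nat \<Rightarrow> nat \<Rightarrow> bool) \<Rightarrow> (nat \<Rightarrow> nat) \<Rightarrow> nat set) \<Rightarrow>
   (nat \<Rightarrow> nat \<Rightarrow> bool) \<Rightarrow> (nat \<Rightarrow> nat) \<Rightarrow> nat list set"
  for R Sel E \<pi> where
  root: "[] \<in> ir_nodes R Sel E \<pi>"
| child: "\<nu> \<in> ir_nodes R Sel E \<pi> \<Longrightarrow> v \<in> Sel E (R E \<pi> \<nu>) \<Longrightarrow> \<nu> @ [v] \<in> ir_nodes R Sel E \<pi>"

definition is_IR_tree ::
  "(nat \<Rightarrow> (nat \<Rightarrow> nat \<Rightarrow> bool) \<Rightarrow> (nat \<Rightarrow> nat) \<Rightarrow> nat list \<Rightarrow> (nat \<Rightarrow> nat)) \<Rightarrow>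
   'a set \<Rightarrow> 'a \<Rightarrow> ('a \<Rightarrow> 'a) \<Rightarrow> bool" where
  "is_IR_tree Ref V r par \<longleftrightarrow>
    (\<exists>n E \<pi> Sel. is_graph n E \<and> is_coloring n \<pi> \<and> cell_selector n Sel \<and>
       rooted_tree_iso (ir_nodes (Ref n) Sel E \<pi>) [] butlast V r par)"

end

theory Submission
  imports Defs "HOL-Library.Nat_Bijection"
begin

text \<open>Necessity: if the selected cell is \<open>{v, w}\<close>, then individualizing \<open>v\<close> makes
  \<open>w\<close> a singleton as well, so both children have the same refined partition, and both or neither
  are leaves.

  Sufficiency: every family of siblings of the tree becomes a cell of a graph, and there is one
  further ``master'' cell of two vertices. The graph is built so that splitting the master cell makes
  every equitable colouring discrete, while splitting siblings alone never splits the master cell unless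
  a leaf is individualized. This one-way behaviour comes from edges whose two ends are
  attached to siblings \<open>c\<close>, \<open>c'\<close>: with an integer matrix \<open>D\<close> on the siblings, the edges with ends
  \<open>(c, c')\<close> are distributed to the two master vertices with multiplicities \<open>1 \<plusminus> D c c'\<close>.
  If \<open>D\<close> has zero row and column sums, an individualized sibling \<open>c\<close> is
  noticed by the master pair iff \<open>D c c \<noteq> 0\<close>; so \<open>D\<close> is chosen with nonzero diagonal
  exactly at the leaves. The graph has no automorphism moving a tree node, which lets
  an invariant cell selector recognise the current node of the tree from the refined colouring.\<close>

subsection \<open>Refinement and necessity\<close>

text \<open>The colours of \<open>is_coloring\<close> must form a segment \<open>{1..k}\<close>, so
  an arbitrary labelling is renamed by enumerating its image; only its kernel survives.\<close>

lemma is_coloring_exists: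
  fixes f :: "nat \<Rightarrow> 'c"
  shows "\<exists>\<sigma>. is_coloring n \<sigma> \<and> (\<forall>v<n. \<forall>w<n. \<sigma> v = \<sigma> w \<longleftrightarrow> f v = f w)"
proof -
  have "finite (f ` {..<n})" by simp
  then obtain h where h: "bij_betw h (f ` {..<n}) {1..card (f ` {..<n})}"
    using ex_bij_betw_nat_finite_1 bij_betw_inv by blast
  define \<sigma> where "\<sigma> v = (if v < n then h (f v) else 0)" for v
  have "\<sigma> ` {..<n} = h ` f ` {..<n}"
    by (force simp: \<sigma>_def)
  then have "is_coloring n \<sigma>"
    using h by (auto simp: is_coloring_def bij_betw_def \<sigma>_def)
  moreover have "\<forall>v<n. \<forall>w<n. \<sigma> v = \<sigma> w \<longleftrightarrow> f v = f w"
    using h by (auto simp: \<sigma>_def bij_betw_def inj_on_def)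
  ultimately show ?thesis by blast
qed

lemma perm_graph_comp:
  assumes "\<phi> permutes S" "\<psi> permutes S"
  shows "perm_graph \<phi> (perm_graph \<psi> E) = perm_graph (\<phi> \<circ> \<psi>) E"
  using assms by (simp add: perm_graph_def o_inv_distrib permutes_bij)

lemma perm_coloring_comp:
  assumes "\<phi> permutes S" "\<psi> permutes S"
  shows "perm_coloring \<phi> (perm_coloring \<psi> \<pi>) = perm_coloring (\<phi> \<circ> \<psi>) \<pi>"
  using assms by (simp add: perm_coloring_def o_inv_distrib permutes_bij o_assoc)

section \<open>Consequences of the refinement axioms for a fixed coloured graph\<close>

locale refined_graph =
  fixes Ref :: "nat \<Rightarrow> (nat \<Rightarrow> nat \<Rightarrow> bool) \<Rightarrow> (nat \<Rightarrow> nat) \<Rightarrow> nat list \<Rightarrow> (nat \<Rightarrow> nat)"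
    and n :: nat and E :: "nat \<Rightarrow> nat \<Rightarrow> bool" and \<pi> :: "nat \<Rightarrow> nat"
  assumes refinement: "refinement Ref"
    and graph: "is_graph n E"
    and coloring: "is_coloring n \<pi>"
begin

abbreviation R :: "nat list \<Rightarrow> nat \<Rightarrow> nat" where
  "R \<equiv> Ref n E \<pi>"

text \<open>The sequences for which \<open>refinement_spec\<close> constrains the result.\<close>

definition valid :: "nat list \<Rightarrow> bool" where
  "valid \<nu> \<longleftrightarrow> distinct \<nu> \<and> set \<nu> \<subseteq> {..<n}"

lemma R_props:
  assumes "valid \<nu>"
  shows R_coloring: "is_coloring n (R \<nu>)"
    and R_equitable: "equitable n E (R \<nu>)"
    and R_finer: "finer n (R \<nu>) \<pi>"
    and R_nth: "\<And>i. i < length \<nu> \<Longrightarrow> R \<nu> (\<nu> ! i) = Suc i"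
    and R_rest: "\<And>v. v < n \<Longrightarrow> v \<notin> set \<nu> \<Longrightarrow> length \<nu> < R \<nu> v"
    and R_coarsest: "\<And>\<sigma>. is_coloring n \<sigma> \<Longrightarrow> equitable n E \<sigma> \<Longrightarrow> finer n \<sigma> \<pi> \<Longrightarrow>
      (\<And>v w. v \<in> set \<nu> \<Longrightarrow> w < n \<Longrightarrow> \<sigma> w = \<sigma> v \<Longrightarrow> w = v) \<Longrightarrow> finer n \<sigma> (R \<nu>)"
  using refinement graph coloring assms
  unfolding refinement_def refinement_spec_def valid_def by blast+

text \<open>Vertices outside the sequence have colours above its length, so an individualization
  colour reveals the position of its vertex.\<close>

lemma R_eq_Suc:
  assumes "valid \<nu>" "i < length \<nu>" "w < n" "R \<nu> w = Suc i"
  shows "w = \<nu> ! i"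
proof -
  have "w \<in> set \<nu>" using R_rest[of \<nu> w] assms by force
  then obtain j where "j < length \<nu>" "w = \<nu> ! j" by (metis in_set_conv_nth)
  then show ?thesis using R_nth[of \<nu> j] assms by simp
qed

lemma R_isolates:
  assumes "valid \<nu>" "v \<in> set \<nu>" "w < n" "R \<nu> w = R \<nu> v"
  shows "w = v"
  using assms by (metis R_eq_Suc R_nth in_set_conv_nth)

text \<open>The refinement of the longer sequence is one of the candidates over which the refinement
  of the shorter one is coarsest.\<close>

lemma R_snoc_finer:
  assumes "valid (\<nu> @ [v])"
  shows "finer n (R (\<nu> @ [v])) (R \<nu>)"
proof (rule R_coarsest)
  show "valid \<nu>" using assms by (simp add: valid_def)
  fix a w assume "a \<in> set \<nu>" "w < n" "R (\<nu> @ [v]) w = R (\<nu> @ [v]) a"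
  then show "w = a" using R_isolates[OF assms, of a w] by simp
qed (use R_props[OF assms] in auto)

lemma selected_cell:
  assumes "cell_selector n Sel" "valid \<nu>" "v \<in> Sel E (R \<nu>)"
  shows "Sel E (R \<nu>) = {w. w < n \<and> R \<nu> w = R \<nu> v}" "card (Sel E (R \<nu>)) > 1" "v < n"
proof -
  have "\<not> discrete n (R \<nu>)"
    using assms(1,3) graph R_coloring[OF assms(2)] unfolding cell_selector_def by fastforce
  then have *: "Sel E (R \<nu>) \<in> cells n (R \<nu>)" "card (Sel E (R \<nu>)) > 1"
    using assms(1) graph R_coloring[OF assms(2)] unfolding cell_selector_def by simp_all
  show "card (Sel E (R \<nu>)) > 1" by fact
  obtain c where "Sel E (R \<nu>) = {w. w < n \<and> R \<nu> w = c}"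
    using *(1) unfolding cells_def by blast
  then show "Sel E (R \<nu>) = {w. w < n \<and> R \<nu> w = R \<nu> v}" "v < n"
    using assms(3) by auto
qed

text \<open>An individualized vertex forms a singleton cell, whereas a selected cell is larger;
  hence no vertex is selected twice.\<close>

lemma selected_valid:
  assumes "cell_selector n Sel" "valid \<nu>" "v \<in> Sel E (R \<nu>)"
  shows "valid (\<nu> @ [v])"
proof -
  have "v \<notin> set \<nu>"
  proof
    assume "v \<in> set \<nu>"
    then have "Sel E (R \<nu>) \<subseteq> {v}"
      using selected_cell(1)[OF assms] R_isolates[OF assms(2)] by auto
    then have "card (Sel E (R \<nu>)) \<le> 1"
      by (metis card_mono finite.emptyI finite.insertI is_singletonI is_singleton_altdef)
    then show False using selected_cell(2)[OF assms] by simp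
  qed
  then show ?thesis using assms(2) selected_cell(3)[OF assms] by (simp add: valid_def)
qed

lemma ir_nodes_valid:
  assumes "cell_selector n Sel" "\<nu> \<in> ir_nodes (Ref n) Sel E \<pi>"
  shows "valid \<nu>"
  using assms(2)
proof induction
  case root
  then show ?case by (simp add: valid_def)
next
  case (child \<nu> v)
  then show ?case using selected_valid[OF assms(1)] by blast
qed

lemma selector_empty_iff:
  assumes "cell_selector n Sel" "valid \<nu>"
  shows "Sel E (R \<nu>) = {} \<longleftrightarrow> discrete n (R \<nu>)"
proof -
  have "is_coloring n (R \<nu>)" using R_coloring assms by blast
  then show ?thesis using assms graph unfolding cell_selector_def
    by (metis card.empty not_less_zero)
qed

text \<open>In a cell of size two, fixing one vertex also fixes the other one.\<close>

lemma discrete_sibling: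
  assumes "cell_selector n Sel" "valid \<nu>" "Sel E (R \<nu>) = {v, w}"
    and "discrete n (R (\<nu> @ [w]))"
  shows "discrete n (R (\<nu> @ [v]))"
proof -
  have vv: "valid (\<nu> @ [v])" and vw: "valid (\<nu> @ [w])"
    using selected_valid[OF assms(1,2)] assms(3) by auto
  have cell: "{v, w} = {x. x < n \<and> R \<nu> x = R \<nu> w}"
    using selected_cell(1)[OF assms(1,2), of w] assms(3) by auto
  have wn: "w < n" using vw by (simp add: valid_def)
  \<comment> \<open>Isolating \<open>v\<close> also isolates \<open>w\<close>, so the refinement at
    \<open>v\<close> is a candidate for the sequence ending in \<open>w\<close>. Discreteness then
    passes to the finer colouring.\<close>
  have fin: "finer n (R (\<nu> @ [v])) (R (\<nu> @ [w]))"
  proof (rule R_coarsest[OF vw])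
    fix a x assume a: "a \<in> set (\<nu> @ [w])" and x: "x < n" "R (\<nu> @ [v]) x = R (\<nu> @ [v]) a"
    show "x = a"
    proof (cases "a = w")
      case True
      have "R \<nu> x = R \<nu> w"
        using R_snoc_finer[OF vv] x True wn unfolding finer_def by blast
      then have "x \<in> {v, w}" unfolding cell using x(1) by simp
      moreover have "w = v" if "x = v"
        by (rule R_isolates[OF vv]) (use that x True wn in simp_all)
      ultimately show ?thesis using True by auto
    next
      case False
      then show ?thesis using a x R_isolates[OF vv, of a x] by simp
    qed
  qed (use R_props[OF vv] in auto)
  show ?thesis
    unfolding discrete_def
  proof (rule inj_onI)
    fix x y assume xy: "x \<in> {..<n}" "y \<in> {..<n}" "R (\<nu> @ [v]) x = R (\<nu> @ [v]) y"
    then have "R (\<nu> @ [w]) x = R (\<nu> @ [w]) y"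
      using fin unfolding finer_def lessThan_iff by blast
    then show "x = y" using assms(4) xy(1,2) unfolding discrete_def by (blast dest: inj_onD)
  qed
qed

end

section \<open>Children in the IR-tree and the necessary condition\<close>

lemma ir_children_bij:
  assumes f: "bij_betw f (ir_nodes R Sel E \<pi>) V" "f [] = r"
    and par: "\<And>\<nu>. \<nu> \<in> ir_nodes R Sel E \<pi> - {[]} \<Longrightarrow> par (f \<nu>) = f (butlast \<nu>)"
    and nu: "\<nu> \<in> ir_nodes R Sel E \<pi>"
  shows "children V r par (f \<nu>) = (\<lambda>v. f (\<nu> @ [v])) ` Sel E (R E \<pi> \<nu>)"
proof (intro equalityI subsetI)
  fix c assume c: "c \<in> children V r par (f \<nu>)"
  then obtain \<mu> where mu: "\<mu> \<in> ir_nodes R Sel E \<pi>" "c = f \<mu>"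
    using f by (auto simp: children_def bij_betw_def)
  have "\<mu> \<noteq> []" using c f mu by (auto simp: children_def)
  then obtain \<kappa> v where k: "\<kappa> \<in> ir_nodes R Sel E \<pi>" "v \<in> Sel E (R E \<pi> \<kappa>)" "\<mu> = \<kappa> @ [v]"
    by (metis ir_nodes.cases mu(1))
  have "f \<kappa> = f \<nu>" using par[of \<mu>] mu k c by (simp add: children_def)
  then have "\<kappa> = \<nu>" using f nu k by (meson bij_betw_def inj_onD)
  then show "c \<in> (\<lambda>v. f (\<nu> @ [v])) ` Sel E (R E \<pi> \<nu>)" using k mu by blast
next
  fix c assume "c \<in> (\<lambda>v. f (\<nu> @ [v])) ` Sel E (R E \<pi> \<nu>)"
  then obtain v where v: "v \<in> Sel E (R E \<pi> \<nu>)" "c = f (\<nu> @ [v])" by blast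
  have m: "\<nu> @ [v] \<in> ir_nodes R Sel E \<pi>" using nu v by (simp add: ir_nodes.child)
  moreover have "f (\<nu> @ [v]) \<noteq> f []"
    using f m ir_nodes.root[of R Sel E \<pi>]
    by (metis Nil_is_append_conv bij_betw_def inj_onD list.distinct(1))
  ultimately show "c \<in> children V r par (f \<nu>)"
    using par[OF _, of "\<nu> @ [v]"] f v by (auto simp: children_def bij_betw_def)
qed

text \<open>Leaves correspond to discrete refinements, and by \<open>discrete_sibling\<close> the
  two vertices of a selected pair have discrete refinements together or not at all.\<close>

lemma IR_tree_leaf_condition:
  assumes "refinement Ref" "is_IR_tree Ref V r par"
    and u: "u \<in> V" "card (children V r par u) = 2"
  shows "card {c \<in> children V r par u. is_leaf V r par c} \<noteq> 1"
proof
  assume one: "card {c \<in> children V r par u. is_leaf V r par c} = 1"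
  obtain n E \<pi> Sel where *: "is_graph n E" "is_coloring n \<pi>" "cell_selector n Sel"
    "rooted_tree_iso (ir_nodes (Ref n) Sel E \<pi>) [] butlast V r par"
    using assms(2) unfolding is_IR_tree_def by blast
  interpret refined_graph Ref n E \<pi>
    using assms(1) * by unfold_locales
  let ?I = "ir_nodes (Ref n) Sel E \<pi>"
  obtain f where f: "bij_betw f ?I V" "f [] = r"
    and par: "\<And>\<nu>. \<nu> \<in> ?I - {[]} \<Longrightarrow> par (f \<nu>) = f (butlast \<nu>)"
    using *(4) unfolding rooted_tree_iso_def by blast
  note ch = ir_children_bij[OF f par]
  obtain \<nu> where nu: "\<nu> \<in> ?I" "f \<nu> = u"
    using f(1) u(1) by (auto simp: bij_betw_def)
  note val = ir_nodes_valid[OF *(3) nu(1)]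
  have inI: "\<nu> @ [v] \<in> ?I" if "v \<in> Sel E (R \<nu>)" for v
    using that nu(1) by (rule ir_nodes.child[rotated])
  have leaf: "is_leaf V r par (f (\<nu> @ [v])) \<longleftrightarrow> discrete n (R (\<nu> @ [v]))"
    if "v \<in> Sel E (R \<nu>)" for v
    using ch[OF _ inI[OF that]] selector_empty_iff[OF *(3) selected_valid[OF *(3) val that]]
    by (simp add: is_leaf_def)
  have "inj_on (\<lambda>v. f (\<nu> @ [v])) (Sel E (R \<nu>))"
    using f(1) inI by (auto simp: bij_betw_def inj_on_def)
  then have "card (Sel E (R \<nu>)) = 2"
    using ch[OF _ nu(1)] nu(2) u(2) by (simp add: card_image)
  then obtain v w where vw: "Sel E (R \<nu>) = {v, w}"
    by (meson card_2_iff)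
  have "discrete n (R (\<nu> @ [v])) \<longleftrightarrow> discrete n (R (\<nu> @ [w]))"
    using discrete_sibling[OF *(3) val] vw by (metis insert_commute)
  then have "(\<forall>c \<in> children V r par u. is_leaf V r par c) \<or> (\<forall>c \<in> children V r par u. \<not> is_leaf V r par c)"
    using leaf vw ch[OF _ nu(1)] nu(2) by auto
  then have "{c \<in> children V r par u. is_leaf V r par c} = children V r par u \<or>
      {c \<in> children V r par u. is_leaf V r par c} = {}"
    by blast
  then show False
  proof
    assume "{c \<in> children V r par u. is_leaf V r par c} = children V r par u"
    then show False using one u(2) by simp
  next
    assume e: "{c \<in> children V r par u. is_leaf V r par c} = {}"
    show False using one unfolding e by simp
  qed
qed

subsection \<open>The gadget graph\<close>

text \<open>A cyclic shift of \<open>{..<m}\<close>, transported along an enumeration, has no fixed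
  point once \<open>m\<close> is at least 2.\<close>

lemma derangement_exists:
  assumes "finite L" "card L \<ge> 2"
  shows "\<exists>\<sigma>. bij_betw \<sigma> L L \<and> (\<forall>x\<in>L. \<sigma> x \<noteq> x)"
proof -
  define m where "m = card L"
  obtain h where h: "bij_betw h {..<m} L"
    using ex_bij_betw_nat_finite[OF assms(1)] by (auto simp: m_def atLeast0LessThan)
  define g where "g = inv_into {..<m} h"
  have g: "bij_betw g L {..<m}" unfolding g_def using h by (rule bij_betw_inv_into)
  have gh: "g (h i) = i" if "i < m" for i
    using h that by (simp add: g_def bij_betw_def inv_into_f_f)
  have hg: "h (g x) = x" if "x \<in> L" for x
    using h that by (simp add: g_def bij_betw_def f_inv_into_f)
  have m: "m \<ge> 2" using assms(2) by (simp add: m_def)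
  have "inj_on (\<lambda>i. Suc i mod m) {..<m}"
    by (rule inj_onI) (auto simp: mod_Suc split: if_splits)
  moreover have "(\<lambda>i. Suc i mod m) ` {..<m} \<subseteq> {..<m}" using m by auto
  ultimately have "bij_betw (\<lambda>i. Suc i mod m) {..<m} {..<m}"
    by (simp add: bij_betw_def endo_inj_surj)
  then have "bij_betw (h \<circ> ((\<lambda>i. Suc i mod m) \<circ> g)) L L"
    using g h by (blast intro: bij_betw_trans)
  moreover have "(h \<circ> ((\<lambda>i. Suc i mod m) \<circ> g)) x \<noteq> x" if "x \<in> L" for x
  proof
    assume "(h \<circ> ((\<lambda>i. Suc i mod m) \<circ> g)) x = x"
    then have "g (h (Suc (g x) mod m)) = g x" by simp
    moreover have "Suc (g x) mod m < m" using m by simp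
    ultimately have "Suc (g x) mod m = g x" using gh by simp
    moreover have "g x < m" using g that by (auto simp: bij_betw_def)
    ultimately show False using m by (auto simp: mod_Suc split: if_splits)
  qed
  ultimately show ?thesis by blast
qed

text \<open>The condition on two siblings with exactly one leaf enters only here: a \<open>2 \<times> 2\<close> matrix
  with zero row and column sums has equal diagonal entries.\<close>

definition balanced_matrix :: "'a set \<Rightarrow> 'a set \<Rightarrow> ('a \<Rightarrow> 'a \<Rightarrow> int) \<Rightarrow> bool" where
  "balanced_matrix C L D \<longleftrightarrow>
     (\<forall>c\<in>C. (\<Sum>d\<in>C. D c d) = 0) \<and> (\<forall>d\<in>C. (\<Sum>c\<in>C. D c d) = 0) \<and>
     (\<forall>c d. D c d \<in> {-1, 0, 1}) \<and> (\<forall>c\<in>C. D c c = (if c \<in> L then 1 else 0))"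

lemma balanced_matrix_exists:
  assumes C: "finite C" "card C \<noteq> 1" "L \<subseteq> C"
    and not_21: "\<not> (card C = 2 \<and> card L = 1)"
  shows "\<exists>D. balanced_matrix C L D"
proof -
  have fL: "finite L" using C finite_subset by blast
  consider "card L = 0" | "card L = 1" | "card L \<ge> 2" by linarith
  then show ?thesis
  proof cases
    case 1
    then have "L = {}" using fL by simp
    then have "balanced_matrix C L (\<lambda>_ _. 0)" by (simp add: balanced_matrix_def)
    then show ?thesis by blast
  next
    case 2
    then obtain l where l: "L = {l}" by (meson card_1_singletonE)
    have "card C \<noteq> 0" using C l by auto
    then have "card C \<ge> 3" using C(2) 2 not_21 by linarith
    then have "card (C - {l}) \<ge> 2" using C l by simp
    then obtain S where S: "S \<subseteq> C - {l}" "card S = 2"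
      by (meson obtain_subset_with_card_n)
    then obtain a b where ab: "a \<in> C - {l}" "b \<in> C - {l}" "a \<noteq> b"
      by (auto simp: card_2_iff)
    \<comment> \<open>The product of the vectors \<open>e_l - e_a\<close> and
      \<open>e_l - e_b\<close>. Each has sum zero, and \<open>a \<noteq> b\<close> keeps the
      diagonal zero away from \<open>l\<close>; this is why two siblings besides \<open>l\<close>
      are required.\<close>
    define D :: "'a \<Rightarrow> 'a \<Rightarrow> int" where
      "D c d = (of_bool (c = l) - of_bool (c = a)) * (of_bool (d = l) - of_bool (d = b))" for c d
    have z: "(\<Sum>c\<in>C. of_bool (c = l) - of_bool (c = x)) = (0::int)" if "x \<in> C" for x
      using that C l by (simp add: sum_subtractf of_bool_def sum.delta)
    have "(\<Sum>d\<in>C. D c d) = 0" for c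
      unfolding D_def using z[of b] ab by (simp flip: sum_distrib_left)
    moreover have "(\<Sum>c\<in>C. D c d) = 0" for d
      unfolding D_def using z[of a] ab by (simp flip: sum_distrib_right)
    moreover have "D c d \<in> {-1, 0, 1}" for c d
      using ab by (auto simp: D_def)
    moreover have "D c c = (if c \<in> L then 1 else 0)" for c
      using ab l by (auto simp: D_def)
    ultimately have "balanced_matrix C L D" by (simp add: balanced_matrix_def)
    then show ?thesis by blast
  next
    case 3
    then obtain \<sigma> where s: "bij_betw \<sigma> L L" "\<forall>x\<in>L. \<sigma> x \<noteq> x"
      using derangement_exists[OF fL] by blast
    \<comment> \<open>The identity on \<open>L\<close> minus the permutation matrix of a
      derangement, extended by zero.\<close>
    define D :: "'a \<Rightarrow> 'a \<Rightarrow> int" where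
      "D c d = of_bool (c \<in> L \<and> d = c) - of_bool (c \<in> L \<and> d = \<sigma> c)" for c d
    have sL: "\<sigma> c \<in> C" if "c \<in> L" for c
      using s that C by (auto simp: bij_betw_def)
    have "(\<Sum>d\<in>C. D c d) = 0" if "c \<in> C" for c
      using that sL C by (cases "c \<in> L") (simp_all add: D_def sum_subtractf of_bool_def sum.delta)
    moreover have "(\<Sum>c\<in>C. D c d) = 0" for d
    proof -
      have restr: "(\<Sum>c\<in>C. D c d) = (\<Sum>c\<in>L. D c d)"
        using C by (intro sum.mono_neutral_right) (auto simp: D_def)
      have "(\<Sum>c\<in>L. of_bool (d = \<sigma> c)) = (\<Sum>c\<in>L. of_bool (d = c) :: int)"
        using sum.reindex_bij_betw[OF s(1), of "\<lambda>c. of_bool (d = c)"] by simp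
      then show ?thesis unfolding restr by (simp add: D_def sum_subtractf)
    qed
    moreover have "D c d \<in> {-1, 0, 1}" for c d
      by (auto simp: D_def)
    moreover have "D c c = (if c \<in> L then 1 else 0)" for c
      using s(2) by (auto simp: D_def)
    ultimately have "balanced_matrix C L D" by (simp add: balanced_matrix_def)
    then show ?thesis by blast
  qed
qed

section \<open>Vertices, colours and edges of the gadget graph\<close>

datatype 'a vertex = Master bool | Node 'a | Row 'a 'a 'a bool | Col 'a 'a 'a bool
  | Pendant "'a vertex" nat

datatype 'a colour = CMaster | CNode 'a bool | CRow 'a 'a bool bool | CCol 'a 'a bool bool
  | CPendant "'a colour" nat

text \<open>Carries the neighbours of one token to those of another token \<open>p\<close>, whose
  tree node is \<open>c\<close>, master vertex \<open>Master b\<close> and partner token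
  \<open>q\<close>.\<close>

fun retarget :: "'a \<Rightarrow> bool \<Rightarrow> 'a vertex \<Rightarrow> 'a vertex \<Rightarrow> 'a vertex \<Rightarrow> 'a vertex" where
  "retarget c b p q (Node _) = Node c"
| "retarget c b p q (Master _) = Master b"
| "retarget c b p q (Pendant _ k) = Pendant p k"
| "retarget c b p q _ = q"

text \<open>Exchanges the two master vertices together with the signs of all tokens.\<close>

fun flip :: "'a vertex \<Rightarrow> 'a vertex" where
  "flip (Master b) = Master (\<not> b)"
| "flip (Row c c' j s) = Row c c' j (\<not> s)"
| "flip (Col c c' j s) = Col c c' j (\<not> s)"
| "flip (Pendant v k) = Pendant (flip v) k"
| "flip v = v"

text \<open>Maps the neighbours of one tree node to those of a sibling \<open>x\<close>, where
  \<open>\<tau>\<close> is meant to exchange the two siblings in both positions of a token.\<close>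

fun swap_node :: "('a \<Rightarrow> 'a) \<Rightarrow> 'a \<Rightarrow> 'a vertex \<Rightarrow> 'a vertex" where
  "swap_node \<tau> x (Row a b j s) = Row (\<tau> a) (\<tau> b) j s"
| "swap_node \<tau> x (Col a b j s) = Col (\<tau> a) (\<tau> b) j s"
| "swap_node \<tau> x (Pendant v k) = Pendant (Node x) k"
| "swap_node \<tau> x v = v"

text \<open>The master pair is reached from siblings only through pairs of adjacent tokens
  \<open>Row c c' j s\<close> and \<open>Col c c' j s\<close>, where \<open>j = r\<close> is the tag of the gadgets that
  propagate from a leaf to the master pair, and \<open>j \<noteq> r\<close> that of the gadgets that recognise
  the sibling \<open>j\<close> once the master pair is split. Pendant vertices encode the initial colour of a
  vertex in the uncoloured graph, because a cell selector does not see the initial colouring.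
  The Boolean arguments of \<open>colour\<close> record whether a sibling has been individualized.\<close>

locale tree_gadget =
  fixes V :: "'a set" and r :: 'a and par :: "'a \<Rightarrow> 'a"
    and idx :: "'a \<Rightarrow> nat" and D :: "'a \<Rightarrow> 'a \<Rightarrow> int"
  assumes tree: "rooted_tree V r par"
    and nontrivial: "V \<noteq> {r}"
    and idx: "inj_on idx V"
    and balanced: "\<And>u. u \<in> V \<Longrightarrow>
      balanced_matrix (children V r par u) {c. is_leaf V r par c} D"
begin

lemma finite_V: "finite V" and root_in: "r \<in> V" and par_in: "v \<in> V \<Longrightarrow> v \<noteq> r \<Longrightarrow> par v \<in> V"
  using tree by (auto simp: rooted_tree_def)

abbreviation ch :: "'a \<Rightarrow> 'a set" where "ch \<equiv> children V r par"

lemma in_ch: "c \<in> ch u \<longleftrightarrow> c \<in> V \<and> c \<noteq> r \<and> par c = u"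
  by (auto simp: children_def)

lemma finite_ch: "finite (ch u)"
  using finite_V by (simp add: children_def)

text \<open>Chooses the master vertex joined to a row token. For \<open>j = r\<close> the two signs
  together reach \<open>Master True\<close> with multiplicity \<open>1 + D c c'\<close> and
  \<open>Master False\<close> with multiplicity \<open>1 - D c c'\<close>. For other tags the row
  end and the column end reach different master vertices exactly when \<open>c = j\<close>.\<close>

fun lift :: "'a \<Rightarrow> 'a \<Rightarrow> 'a \<Rightarrow> bool \<Rightarrow> bool" where
  "lift c c' j s = (if j = r then (if D c c' = 0 then s else D c c' = 1) else s \<noteq> (c = j))"

declare lift.simps [simp del]

definition token :: "'a \<Rightarrow> 'a \<Rightarrow> 'a \<Rightarrow> bool" where
  "token c c' j \<longleftrightarrow> c \<in> V \<and> c \<noteq> r \<and> c' \<in> V \<and> c' \<noteq> r \<and> par c = par c' \<and> j \<in> V"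

fun core :: "'a vertex \<Rightarrow> bool" where
  "core (Master b) = True"
| "core (Node c) = (c \<in> V \<and> c \<noteq> r)"
| "core (Row c c' j s) = token c c' j"
| "core (Col c c' j s) = token c c' j"
| "core (Pendant v k) = False"

text \<open>On core vertices this encodes the kind, the parent and the tag injectively. The
  \<open>Suc\<close> gives every core vertex at least one pendant, so the value 0 marks the
  pendants.\<close>

fun cnt :: "'a vertex \<Rightarrow> nat" where
  "cnt (Master b) = Suc (prod_encode (0, 0))"
| "cnt (Node c) = Suc (prod_encode (1, idx (par c)))"
| "cnt (Row c c' j s) = Suc (prod_encode (2, prod_encode (idx (par c), idx j)))"
| "cnt (Col c c' j s) = Suc (prod_encode (3, prod_encode (idx (par c), idx j)))"
| "cnt (Pendant v k) = 0"

fun vert :: "'a vertex \<Rightarrow> bool" where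
  "vert (Pendant v k) = (core v \<and> k < cnt v)"
| "vert v = core v"

fun arc :: "'a vertex \<Rightarrow> 'a vertex \<Rightarrow> bool" where
  "arc (Row c c' j s) w = (w = Node c \<or> w = Master (lift c c' j s) \<or> w = Col c c' j s)"
| "arc (Col c c' j s) w = (w = Node c' \<or> w = Master s)"
| "arc (Pendant v k) w = (w = v)"
| "arc _ w = False"

definition adj :: "'a vertex \<Rightarrow> 'a vertex \<Rightarrow> bool" where
  "adj v w \<longleftrightarrow> vert v \<and> vert w \<and> (arc v w \<or> arc w v)"

fun colour :: "'a set \<Rightarrow> 'a vertex \<Rightarrow> 'a colour" where
  "colour A (Master b) = CMaster"
| "colour A (Node c) = CNode (par c) (c \<in> A)"
| "colour A (Row c c' j s) = CRow (par c) j (c \<in> A) (c' \<in> A)"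
| "colour A (Col c c' j s) = CCol (par c) j (c \<in> A) (c' \<in> A)"
| "colour A (Pendant v k) = CPendant (colour A v) k"

text \<open>Equitability on the structured vertex type, with labels of any type, so that it applies
  both to \<open>colour A\<close> and to a numerical refinement.\<close>

definition stable :: "('a vertex \<Rightarrow> 'c) \<Rightarrow> bool" where
  "stable \<rho> \<longleftrightarrow> (\<forall>v w. vert v \<and> vert w \<and> \<rho> v = \<rho> w \<longrightarrow>
     (\<forall>k. card {u. adj v u \<and> \<rho> u = k} = card {u. adj w u \<and> \<rho> u = k}))"

lemma core_vert: "core v \<Longrightarrow> vert v"
  by (cases v) auto

lemma adj_sym: "adj v w \<longleftrightarrow> adj w v"
  by (auto simp: adj_def)

lemma adj_vert: "adj v w \<Longrightarrow> vert v \<and> vert w"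
  by (simp add: adj_def)

lemma adj_irrefl: "\<not> adj v v"
  by (cases v) (auto simp: adj_def)

lemma finite_core: "finite {v. core v}"
proof -
  have "{v. core v} \<subseteq> Master ` UNIV \<union> Node ` V
      \<union> (\<lambda>(c, c', j, s). Row c c' j s) ` (V \<times> V \<times> V \<times> UNIV)
      \<union> (\<lambda>(c, c', j, s). Col c c' j s) ` (V \<times> V \<times> V \<times> UNIV)"
    (is "_ \<subseteq> ?U")
  proof
    fix v assume "v \<in> {v. core v}"
    then show "v \<in> ?U"
      by (cases v) (auto simp: token_def image_iff)
  qed
  moreover have "finite ?U" using finite_V by simp
  ultimately show ?thesis by (rule finite_subset)
qed

lemma finite_vert: "finite {v. vert v}"
proof -
  have "{v. vert v} \<subseteq> {v. core v} \<union> (\<Union>v\<in>{v. core v}. Pendant v ` {..<cnt v})"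
  proof
    fix v assume "v \<in> {v. vert v}"
    then show "v \<in> {v. core v} \<union> (\<Union>v\<in>{v. core v}. Pendant v ` {..<cnt v})"
      by (cases v) auto
  qed
  moreover have "finite \<dots>" using finite_core by simp
  ultimately show ?thesis by (rule finite_subset)
qed

lemma finite_adj: "finite {u. adj v u \<and> P u}" "finite {u. adj v u}"
  using finite_vert by (auto intro: finite_subset[rotated] simp: adj_def)

lemma adj_Node: "adj (Node c) u \<longleftrightarrow> c \<in> V \<and> c \<noteq> r \<and>
   ((\<exists>c' j s. u = Row c c' j s \<and> token c c' j) \<or> (\<exists>c' j s. u = Col c' c j s \<and> token c' c j)
     \<or> (\<exists>k. u = Pendant (Node c) k \<and> k < cnt (Node c)))"
  by (cases u) (auto simp: adj_def token_def)

lemma adj_Master: "adj (Master b) u \<longleftrightarrow>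
   ((\<exists>c c' j s. u = Row c c' j s \<and> token c c' j \<and> lift c c' j s = b)
     \<or> (\<exists>c c' j. u = Col c c' j b \<and> token c c' j)
     \<or> (\<exists>k. u = Pendant (Master b) k \<and> k < cnt (Master b)))"
  by (cases u) (auto simp: adj_def)

lemma adj_Row: "adj (Row c c' j s) u \<longleftrightarrow> token c c' j \<and>
   (u = Node c \<or> u = Master (lift c c' j s) \<or> u = Col c c' j s
     \<or> (\<exists>k. u = Pendant (Row c c' j s) k \<and> k < cnt (Row c c' j s)))"
  by (cases u) (auto simp: adj_def token_def)

lemma adj_Col: "adj (Col c c' j s) u \<longleftrightarrow> token c c' j \<and>
   (u = Node c' \<or> u = Master s \<or> u = Row c c' j s
     \<or> (\<exists>k. u = Pendant (Col c c' j s) k \<and> k < cnt (Col c c' j s)))"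
  by (cases u) (auto simp: adj_def token_def)

lemma adj_Pendant: "adj (Pendant v k) u \<longleftrightarrow> core v \<and> k < cnt v \<and> u = v"
  by (cases u; cases v) (auto simp: adj_def)

section \<open>Stable colourings that mark inner nodes only\<close>

lemma card_adj_eq:
  assumes "\<And>u. adj v u \<Longrightarrow> \<rho> u = k \<Longrightarrow> adj w (\<beta> u) \<and> \<gamma> (\<beta> u) = u \<and> \<rho> (\<beta> u) = k"
    and "\<And>u. adj w u \<Longrightarrow> \<rho> u = k \<Longrightarrow> adj v (\<gamma> u) \<and> \<beta> (\<gamma> u) = u \<and> \<rho> (\<gamma> u) = k"
  shows "card {u. adj v u \<and> \<rho> u = k} = card {u. adj w u \<and> \<rho> u = k}"
proof (rule bij_betw_same_card)
  show "bij_betw \<beta> {u. adj v u \<and> \<rho> u = k} {u. adj w u \<and> \<rho> u = k}"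
    by (rule bij_betw_byWitness[where f' = \<gamma>]) (use assms in auto)
qed

text \<open>The number of pairs \<open>(c, c')\<close> attached to either master vertex deviates by
  \<open>D c c'\<close> in opposite directions.\<close>

lemma card_lift: "int (card {s. lift c c' r s = d}) = 1 + (if d then D c c' else - D c c')"
  if "D c c' \<in> {-1, 0, 1}"
proof -
  have "{s. lift c c' r s = d} =
    (if D c c' = 0 then {d} else if (D c c' = 1) = d then {True, False} else {})"
    using that by (auto simp: lift.simps)
  then show ?thesis using that by auto
qed

lemma D_range: "D c d \<in> {-1, 0, 1}"
  using balanced[OF root_in] by (simp add: balanced_matrix_def)

text \<open>The set \<open>A\<close> contains at most one child of \<open>u\<close>, and that child
  is not a leaf, so the block of \<open>D\<close> inside \<open>A\<close> is empty or a zero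
  diagonal entry. Zero row and column sums then annihilate the other three blocks.\<close>

lemma block_sum_zero:
  assumes u: "u \<in> V" and A: "\<And>c. c \<in> A \<Longrightarrow> \<not> is_leaf V r par c"
    "\<And>c d. c \<in> A \<inter> ch u \<Longrightarrow> d \<in> A \<inter> ch u \<Longrightarrow> c = d"
  shows "(\<Sum>c | c \<in> ch u \<and> (c \<in> A) = a. \<Sum>c' | c' \<in> ch u \<and> (c' \<in> A) = b. D c c') = 0"
proof -
  note bal = balanced[OF u, unfolded balanced_matrix_def]
  have split: "(\<Sum>c | c \<in> ch u \<and> (c \<in> A) = a. f c) = 
      (if a then (\<Sum>c | c \<in> ch u \<and> c \<in> A. f c)
       else (\<Sum>c\<in>ch u. f c) - (\<Sum>c | c \<in> ch u \<and> c \<in> A. f c))" for a and f :: "'a \<Rightarrow> int"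
  proof (cases a)
    case False
    have "{c. c \<in> ch u \<and> (c \<in> A) = a} = ch u - {c. c \<in> ch u \<and> c \<in> A}" using False by auto
    then show ?thesis using False finite_ch by (simp add: sum_diff)
  qed simp
  define g where "g c = (\<Sum>c' | c' \<in> ch u \<and> c' \<in> A. D c c')" for c
  have inner: "(\<Sum>c' | c' \<in> ch u \<and> (c' \<in> A) = b. D c c') = (if b then g c else - g c)"
    if "c \<in> ch u" for c
    unfolding split g_def using bal that by auto
  have h: "(\<Sum>c | c \<in> ch u \<and> c \<in> A. g c) = 0"
  proof (cases "ch u \<inter> A = {}")
    case True
    then have e: "{c. c \<in> ch u \<and> c \<in> A} = {}" by blast
    show ?thesis unfolding e by simp
  next
    case False
    then obtain v where v: "v \<in> ch u" "v \<in> A" by blast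
    then have e: "{c. c \<in> ch u \<and> c \<in> A} = {v}" using A(2) by blast
    have "D v v = 0" using bal v A(1)[of v] by auto
    then show ?thesis unfolding g_def e by simp
  qed
  have t: "(\<Sum>c\<in>ch u. g c) = 0"
  proof -
    have "(\<Sum>c\<in>ch u. g c) = (\<Sum>c' | c' \<in> ch u \<and> c' \<in> A. \<Sum>c\<in>ch u. D c c')"
      unfolding g_def by (rule sum.swap)
    also have "\<dots> = 0" using bal by (intro sum.neutral) auto
    finally show ?thesis .
  qed
  have "(\<Sum>c | c \<in> ch u \<and> (c \<in> A) = a. \<Sum>c' | c' \<in> ch u \<and> (c' \<in> A) = b. D c c')
      = (\<Sum>c | c \<in> ch u \<and> (c \<in> A) = a. if b then g c else - g c)"
    by (rule sum.cong) (use inner in auto)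
  also have "\<dots> = 0"
    unfolding split by (cases b) (simp_all add: sum_negf h t)
  finally show ?thesis .
qed

text \<open>Each pair contributes \<open>1 + D c c'\<close> or \<open>1 - D c c'\<close>, and the
  deviations cancel over a block. The count is thus the same for both master vertices.\<close>

lemma card_Master_Row:
  assumes u: "u \<in> V" and A: "\<And>c. c \<in> A \<Longrightarrow> \<not> is_leaf V r par c"
    "\<And>c d. c \<in> A \<inter> ch u \<Longrightarrow> d \<in> A \<inter> ch u \<Longrightarrow> c = d"
  shows "card {w. adj (Master d) w \<and> colour A w = CRow u r a b} =
    card {c. c \<in> ch u \<and> (c \<in> A) = a} * card {c. c \<in> ch u \<and> (c \<in> A) = b}"
proof -
  define C where "C a = {c. c \<in> ch u \<and> (c \<in> A) = a}" for a
  have finC: "finite (C a)" for a using finite_ch by (simp add: C_def)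
  let ?S = "SIGMA c:C a. SIGMA c':C b. {s. lift c c' r s = d}"
  have "{w. adj (Master d) w \<and> colour A w = CRow u r a b} = (\<lambda>(c, c', s). Row c c' r s) ` ?S"
    by (auto simp: adj_Master C_def in_ch token_def root_in image_iff)
  moreover have "inj_on (\<lambda>(c, c', s). Row c c' r s) ?S"
    by (auto simp: inj_on_def)
  ultimately have "card {w. adj (Master d) w \<and> colour A w = CRow u r a b} = card ?S"
    by (simp add: card_image)
  also have "\<dots> = (\<Sum>c\<in>C a. \<Sum>c'\<in>C b. card {s. lift c c' r s = d})"
    using finC by (simp add: card_SigmaI)
  finally have "int (card {w. adj (Master d) w \<and> colour A w = CRow u r a b})
     = (\<Sum>c\<in>C a. \<Sum>c'\<in>C b. 1 + (if d then D c c' else - D c c'))"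
    using card_lift[OF D_range] by simp
  also have "\<dots> = int (card (C a) * card (C b)) + (if d then 1 else -1) * (\<Sum>c\<in>C a. \<Sum>c'\<in>C b. D c c')"
    by (simp add: sum.distrib sum_negf)
  also have "(\<Sum>c\<in>C a. \<Sum>c'\<in>C b. D c c') = 0"
    unfolding C_def by (rule block_sum_zero[OF u A])
  finally have "int (card {w. adj (Master d) w \<and> colour A w = CRow u r a b}) =
      int (card (C a) * card (C b))"
    by simp
  then show ?thesis unfolding C_def of_nat_eq_iff .
qed

lemma colour_of_cnt:
  assumes "core v" "core w" "cnt v = cnt w"
  shows "colour {} v = colour {} w"
  using assms inj_onD[OF idx] par_in
  by (cases v; cases w) (auto simp: token_def)

text \<open>Individualizing inner nodes, at most one in each family of siblings, is not noticed
  outside their own tokens and pendants. Explicit bijections match the neighbourhoods of equally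
  coloured vertices; only the row tokens with tag \<open>r\<close> at the master pair need a
  count.\<close>

lemma stable_colour:
  assumes A: "\<And>c. c \<in> A \<Longrightarrow> \<not> is_leaf V r par c"
    "\<And>c d. c \<in> A \<Longrightarrow> d \<in> A \<Longrightarrow> par c = par d \<Longrightarrow> c = d"
  shows "stable (colour A)"
  unfolding stable_def
proof (intro allI impI, elim conjE)
  fix v w k assume vw: "vert v" "vert w" and eq: "colour A v = colour A w"
  show "card {u. adj v u \<and> colour A u = k} = card {u. adj w u \<and> colour A u = k}"
  proof (cases v)
    case (Master b)
    with eq obtain b' where w: "w = Master b'" by (cases w) auto
    \<comment> \<open>Flipping signs matches the two master neighbourhoods except at row tokens with
      tag \<open>r\<close>, where a nonzero entry of \<open>D\<close> fixes the master vertex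
      whatever the sign. Those are counted by \<open>card_Master_Row\<close>.\<close>
    show ?thesis
    proof (cases "b' = b \<or> (\<exists>u x y. k = CRow u r x y)")
      case True
      then consider "b' = b" | u x y where "k = CRow u r x y" "u \<in> V" 
        | u x y where "k = CRow u r x y" "u \<notin> V" by blast
      then show ?thesis
      proof cases
        case 1
        then show ?thesis by (simp add: w Master)
      next
        case 2
        have AA: "\<And>c d. c \<in> A \<inter> ch u \<Longrightarrow> d \<in> A \<inter> ch u \<Longrightarrow> c = d"
          using A(2) by (auto simp: in_ch)
        have "card {z. adj (Master d) z \<and> colour A z = k} =
            card {c. c \<in> ch u \<and> (c \<in> A) = x} * card {c. c \<in> ch u \<and> (c \<in> A) = y}" for d
          unfolding 2(1) by (rule card_Master_Row[OF 2(2)]) (use A(1) AA in auto)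
        then show ?thesis by (simp add: w Master)
      next
        case 3
        have none: "{z. adj (Master d) z \<and> colour A z = k} = {}" for d
        proof -
          have "\<not> (adj (Master d) z \<and> colour A z = k)" for z
            using 3 par_in by (cases z) (simp_all add: adj_Master token_def, blast)
          then show ?thesis by blast
        qed
        show ?thesis unfolding w Master none ..
      qed
    next
      case False
      then have b': "b' = (\<not> b)" by blast
      have *: "adj (Master (\<not> d)) (flip u) \<and> flip (flip u) = u \<and> colour A (flip u) = k"
        if "adj (Master d) u" "colour A u = k" for d u
        using that False by (cases u) (auto simp: adj_Master lift.simps)
      show ?thesis
        unfolding w Master b'
        by (rule card_adj_eq[where \<beta> = flip and \<gamma> = flip]) (use *[of b] *[of "\<not> b"] in auto)
    qed
  next
    case (Node c)
    with eq obtain c2 where w: "w = Node c2" and c2: "par c2 = par c" "c2 \<in> A \<longleftrightarrow> c \<in> A"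
      by (cases w) auto
    \<comment> \<open>The siblings \<open>c\<close> and \<open>c2\<close> lie both in
      \<open>A\<close> or both outside it, so exchanging them in all tokens preserves the
      labels.\<close>
    define \<tau> where "\<tau> = transpose c c2"
    have cV: "c \<in> V" "c \<noteq> r" "c2 \<in> V" "c2 \<noteq> r" using vw by (auto simp: w Node)
    have t: "\<tau> x \<in> V \<longleftrightarrow> x \<in> V" "\<tau> x \<noteq> r \<longleftrightarrow> x \<noteq> r" "par (\<tau> x) = par x" "\<tau> x \<in> A \<longleftrightarrow> x \<in> A"
      "\<tau> (\<tau> x) = x" "\<tau> c = c2" "\<tau> c2 = c" for x
      using c2 cV by (auto simp: \<tau>_def transpose_def)
    have tok: "token (\<tau> x) (\<tau> y) j \<longleftrightarrow> token x y j" for x y j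
      using t by (simp add: token_def)
    have *: "adj (Node (\<tau> x)) (swap_node \<tau> (\<tau> x) u) \<and> swap_node \<tau> x (swap_node \<tau> (\<tau> x) u) = u
        \<and> colour A (swap_node \<tau> (\<tau> x) u) = colour A u"
      if "adj (Node x) u" for x u
      using that t tok by (auto simp: adj_Node)
    show ?thesis
      unfolding w Node
      by (rule card_adj_eq[where \<beta> = "swap_node \<tau> c2" and \<gamma> = "swap_node \<tau> c"])
        (use *[of c] *[of c2] t in auto)
  next
    case (Row c c' j s)
    with eq obtain e e' t where w: "w = Row e e' j t"
      and e: "par e = par c" "e \<in> A \<longleftrightarrow> c \<in> A" "e' \<in> A \<longleftrightarrow> c' \<in> A"
      by (cases w) auto
    show ?thesis
      unfolding w Row
      by (rule card_adj_eq[where \<beta> = "retarget e (lift e e' j t) (Row e e' j t) (Col e e' j t)"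
            and \<gamma> = "retarget c (lift c c' j s) (Row c c' j s) (Col c c' j s)"])
        (use vw e in \<open>auto simp: adj_Row w Row\<close>)
  next
    case (Col c c' j s)
    with eq obtain e e' t where w: "w = Col e e' j t"
      and e: "par e = par c" "e \<in> A \<longleftrightarrow> c \<in> A" "e' \<in> A \<longleftrightarrow> c' \<in> A"
      by (cases w) auto
    show ?thesis
      unfolding w Col
      by (rule card_adj_eq[where \<beta> = "retarget e' t (Col e e' j t) (Row e e' j t)"
            and \<gamma> = "retarget c' s (Col c c' j s) (Row c c' j s)"])
        (use vw e in \<open>auto simp: adj_Col w Col token_def\<close>)
  next
    case (Pendant x i)
    with eq obtain y where w: "w = Pendant y i" and y: "colour A y = colour A x"
      by (cases w) auto
    show ?thesis
      unfolding w Pendant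
      by (rule card_adj_eq[where \<beta> = "\<lambda>_. y" and \<gamma> = "\<lambda>_. x"])
        (use vw y in \<open>auto simp: adj_Pendant w Pendant\<close>)
  qed
qed

section \<open>Discreteness once a leaf is isolated\<close>

lemma stable_neighbour:
  assumes "stable \<rho>" "vert v" "vert w" "\<rho> v = \<rho> w" "adj v u"
  obtains u' where "adj w u'" "\<rho> u' = \<rho> u"
proof -
  have "card {x. adj v x \<and> \<rho> x = \<rho> u} = card {x. adj w x \<and> \<rho> x = \<rho> u}"
    using assms unfolding stable_def by blast
  moreover have "card {x. adj v x \<and> \<rho> x = \<rho> u} \<noteq> 0"
    using assms(5) finite_adj by auto
  ultimately have "{x. adj w x \<and> \<rho> x = \<rho> u} \<noteq> {}"
    by (metis card.empty)
  then show thesis using that by blast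
qed

text \<open>From a fixed leaf \<open>l\<close> the tokens \<open>Row l l r s\<close> are recognised, and both are attached to
  the same master vertex since \<open>D l l = 1\<close>. So the master pair splits, and the tokens
  \<open>Row c c c s\<close> then tell every \<open>c\<close> from its siblings.\<close>

lemma stable_discrete:
  assumes st: "stable \<rho>"
    and ref: "\<And>v w. vert v \<Longrightarrow> vert w \<Longrightarrow> \<rho> v = \<rho> w \<Longrightarrow> colour {} v = colour {} w"
    and l: "l \<in> V" "l \<noteq> r" "is_leaf V r par l"
    and iso: "\<And>w. vert w \<Longrightarrow> \<rho> w = \<rho> (Node l) \<Longrightarrow> w = Node l"
  shows "inj_on \<rho> {v. vert v}"
proof -
  note nb = stable_neighbour[OF st]
  have Dll: "D l l = 1"
    using balanced[OF par_in[OF l(1,2)]] l by (auto simp: balanced_matrix_def in_ch)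
  have tl: "token l l r" using l root_in by (simp add: token_def)
  have M: "\<rho> (Master True) \<noteq> \<rho> (Master False)"
  proof
    assume eq: "\<rho> (Master True) = \<rho> (Master False)"
    have "adj (Master True) (Row l l r True)"
      using tl Dll by (auto simp: adj_Master lift.simps)
    then obtain x where x: "adj (Master False) x" "\<rho> x = \<rho> (Row l l r True)"
      using nb[OF _ _ eq] by auto
    have vx: "vert x" using x(1) adj_vert by blast
    have vR: "vert (Row l l r True)" "vert (Col l l r True)" using tl by simp_all
    from ref[OF vx vR(1) x(2)] obtain a b s where xx: "x = Row a b r s"
      by (cases x) auto
    obtain y where y: "adj x y" "\<rho> y = \<rho> (Node l)"
      using nb[OF vR(1) vx x(2)[symmetric], of "Node l"] tl by (auto simp: adj_Row)
    then have "y = Node l" using iso adj_vert by blast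
    then have a: "a = l" using y(1) by (simp add: xx adj_Row)
    obtain z where z: "adj x z" "\<rho> z = \<rho> (Col l l r True)"
      using nb[OF vR(1) vx x(2)[symmetric], of "Col l l r True"] tl by (auto simp: adj_Row)
    have vz: "vert z" using z(1) adj_vert by blast
    from ref[OF vz vR(2) z(2)] z(1) have zz: "z = Col a b r s"
      by (cases z) (auto simp: xx adj_Row)
    obtain q where q: "adj z q" "\<rho> q = \<rho> (Node l)"
      using nb[OF vR(2) vz z(2)[symmetric], of "Node l"] tl by (auto simp: adj_Col)
    then have "q = Node l" using iso adj_vert by blast
    then have b: "b = l" using q(1) by (simp add: zz adj_Col)
    show False using x(1) Dll by (simp add: xx a b adj_Master lift.simps)
  qed
  have sM: "w = Master b" if "vert w" "\<rho> w = \<rho> (Master b)" for w b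
  proof -
    from ref[OF that(1) _ that(2)] obtain b' where "w = Master b'" by (cases w) auto
    then show ?thesis using M that(2) by (cases b; cases b') auto
  qed
  \<comment> \<open>The row token \<open>Row c c c True\<close> meets \<open>Master False\<close>
    while its partner meets \<open>Master True\<close>. An equally labelled token
    \<open>Row d b c s\<close> at \<open>Node d\<close> must show the same crossing, which for the
    tag \<open>c\<close> happens only if \<open>d = c\<close>.\<close>
  have sN: "c = d" if c: "c \<in> V" "c \<noteq> r" and d: "d \<in> V" "d \<noteq> r"
    and eq: "\<rho> (Node c) = \<rho> (Node d)" for c d
  proof -
    have vc: "vert (Node c)" and vd: "vert (Node d)" using c d by simp_all
    have tok: "token c c c" using c by (simp add: token_def)
    have vR: "vert (Row c c c True)" "vert (Col c c c True)" using tok by simp_all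
    have "adj (Node c) (Row c c c True)" using tok c by (auto simp: adj_Node)
    then obtain x where x: "adj (Node d) x" "\<rho> x = \<rho> (Row c c c True)"
      using nb[OF vc vd eq] by blast
    have vx: "vert x" using x(1) adj_vert by blast
    from ref[OF vx vR(1) x(2)] x(1) obtain b s where xx: "x = Row d b c s"
      by (cases x) (auto simp: adj_Node)
    obtain y where y: "adj x y" "\<rho> y = \<rho> (Master False)"
      using nb[OF vR(1) vx x(2)[symmetric], of "Master False"] tok c
      by (auto simp: adj_Row lift.simps)
    then have "y = Master False" using sM adj_vert by blast
    then have lift: "\<not> lift d b c s" using y(1) by (simp add: xx adj_Row)
    obtain z where z: "adj x z" "\<rho> z = \<rho> (Col c c c True)"
      using nb[OF vR(1) vx x(2)[symmetric], of "Col c c c True"] tok by (auto simp: adj_Row)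
    have vz: "vert z" using z(1) adj_vert by blast
    from ref[OF vz vR(2) z(2)] z(1) have zz: "z = Col d b c s"
      by (cases z) (auto simp: xx adj_Row)
    obtain q where q: "adj z q" "\<rho> q = \<rho> (Master True)"
      using nb[OF vR(2) vz z(2)[symmetric], of "Master True"] tok by (auto simp: adj_Col)
    then have "q = Master True" using sM adj_vert by blast
    then have "s" using q(1) by (simp add: zz adj_Col)
    then show "c = d" using lift c by (simp add: lift.simps)
  qed
  have sN': "w = Node c" if "vert w" "\<rho> w = \<rho> (Node c)" "vert (Node c)" for w c
  proof -
    from ref[OF that(1) _ that(2)] that(3) obtain d where "w = Node d" by (cases w) auto
    then show ?thesis using sN[of d c] that by simp
  qed
  \<comment> \<open>The master neighbour of a column token gives its sign, its tree node gives
    \<open>b\<close>, and the tree node of its row partner gives \<open>a\<close>.\<close>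
  have colC: "v = w" if v: "v = Col a b j s" "vert v" and w: "vert w" and eq: "\<rho> v = \<rho> w" for v w a b j s
  proof -
    from ref[OF v(2) w eq] v(1) obtain a' b' s' where w': "w = Col a' b' j s'" by (cases w) auto
    have tok: "token a b j" "token a' b' j" using v w w' by simp_all
    obtain x where x: "adj w x" "\<rho> x = \<rho> (Master s)"
      using nb[OF v(2) w eq, of "Master s"] tok v(1) by (auto simp: adj_Col)
    then have "x = Master s" using sM adj_vert by blast
    then have s: "s' = s" using x(1) w' by (simp add: adj_Col)
    have vN: "vert (Node a)" "vert (Node b)" using tok by (simp_all add: token_def)
    obtain y where y: "adj w y" "\<rho> y = \<rho> (Node b)"
      using nb[OF v(2) w eq, of "Node b"] tok v(1) by (auto simp: adj_Col)
    then have "y = Node b" using sN' vN adj_vert by blast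
    then have b: "b' = b" using y(1) w' by (simp add: adj_Col)
    obtain z where z: "adj w z" "\<rho> z = \<rho> (Row a b j s)"
      using nb[OF v(2) w eq, of "Row a b j s"] tok v(1) by (auto simp: adj_Col)
    have vz: "vert z" using z(1) adj_vert by blast
    have vR: "vert (Row a b j s)" using tok by simp
    from ref[OF vz vR z(2)] z(1) have zz: "z = Row a' b' j s'"
      by (cases z) (auto simp: w' adj_Col)
    obtain q where q: "adj z q" "\<rho> q = \<rho> (Node a)"
      using nb[OF vR vz z(2)[symmetric], of "Node a"] tok by (auto simp: adj_Row)
    then have "q = Node a" using sN' vN adj_vert by blast
    then have a: "a' = a" using q(1) zz by (simp add: adj_Row)
    show ?thesis by (simp add: v(1) w' a b s)
  qed
  have core_inj: "v = w" if v: "core v" and w: "vert w" and eq: "\<rho> v = \<rho> w" for v w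
  proof (cases v)
    case (Master b)
    then show ?thesis using sM[OF w, of b] eq[symmetric] by simp
  next
    case (Node c)
    then show ?thesis using sN'[OF w, of c] eq[symmetric] v by simp
  next
    case (Col a b j s)
    then show ?thesis using colC[of v a b j s w] v w eq by simp
  next
    case (Row a b j s)
    \<comment> \<open>With tag \<open>r\<close> and a nonzero entry of \<open>D\<close>, the master
      neighbour does not determine the sign; the row token is identified through its column partner
      instead.\<close>
    from ref[OF core_vert[OF v] w eq] Row obtain a' b' s' where w': "w = Row a' b' j s'"
      by (cases w) auto
    have tok: "token a b j" using v Row by simp
    have vC: "vert (Col a b j s)" using tok by simp
    obtain z where z: "adj w z" "\<rho> z = \<rho> (Col a b j s)"
      using nb[OF core_vert[OF v] w eq, of "Col a b j s"] tok Row by (auto simp: adj_Row)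
    have vz: "vert z" using z(1) adj_vert by blast
    from ref[OF vz vC z(2)] z(1) have zz: "z = Col a' b' j s'"
      by (cases z) (auto simp: w' adj_Row)
    have "Col a b j s = z" using colC[OF refl vC vz] z(2) by simp
    then show ?thesis by (simp add: zz Row w')
  qed (use v in simp)
  show ?thesis
  proof (rule inj_onI)
    fix v w assume "v \<in> {v. vert v}" "w \<in> {v. vert v}" and eq: "\<rho> v = \<rho> w"
    then have v: "vert v" and w: "vert w" by simp_all
    show "v = w"
    proof (cases "core v")
      case True
      then show ?thesis using core_inj w eq by blast
    next
      case False
      then obtain x k where vx: "v = Pendant x k" using v by (cases v) auto
      with ref[OF v w eq] obtain y where wy: "w = Pendant y k" by (cases w) auto
      obtain u where u: "adj w u" "\<rho> u = \<rho> x"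
        using nb[OF v w eq, of x] v vx by (auto simp: adj_Pendant)
      then have "u = y" by (simp add: wy adj_Pendant)
      moreover have "core x" "core y" using v w vx wy by simp_all
      ultimately have "x = y" using core_inj[of x y] u(2) core_vert by simp
      then show ?thesis by (simp add: vx wy)
    qed
  qed
qed

section \<open>Rigidity of the tree nodes\<close>

definition deg :: "'a vertex \<Rightarrow> nat" where
  "deg v = card {u. adj v u}"

lemma deg_Pendant: "vert (Pendant v k) \<Longrightarrow> deg (Pendant v k) = 1"
  by (simp add: deg_def adj_Pendant)

lemma exists_node: "\<exists>c. c \<in> V \<and> c \<noteq> r"
  using nontrivial root_in by blast

text \<open>Every core vertex has two visible neighbours, so degree one singles out the
  pendants.\<close>

lemma deg_core:
  assumes "core v"
  shows "deg v \<noteq> 1"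
proof
  assume "deg v = 1"
  then obtain x where x: "{u. adj v u} = {x}" unfolding deg_def by (meson card_1_singletonE)
  obtain c where c: "c \<in> V" "c \<noteq> r" using exists_node by blast
  have 1: "adj v u \<Longrightarrow> u = x" for u using x by blast
  show False
  proof (cases v)
    case (Master b)
    show False using 1[of "Col c c r b"] 1[of "Pendant v 0"] c root_in
      by (auto simp: Master adj_Master token_def)
  next
    case (Node d)
    show False using 1[of "Col d d r True"] 1[of "Row d d r True"] assms root_in
      by (auto simp: Node adj_Node token_def)
  next
    case (Row a b j s)
    show False using 1[of "Node a"] 1[of "Col a b j s"] assms
      by (auto simp: Row adj_Row)
  next
    case (Col a b j s)
    show False using 1[of "Node b"] 1[of "Row a b j s"] assms
      by (auto simp: Col adj_Col)
  qed (use assms in simp)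
qed

text \<open>This makes \<open>cnt\<close>, and with it the initial colour of a core vertex, readable
  from the uncoloured graph.\<close>

lemma card_pendants:
  assumes "vert v"
  shows "card {u. adj v u \<and> deg u = 1} = cnt v"
proof (cases "core v")
  case True
  have "{u. adj v u \<and> deg u = 1} = Pendant v ` {..<cnt v}"
  proof (intro equalityI subsetI)
    fix u assume "u \<in> {u. adj v u \<and> deg u = 1}"
    then have u: "adj v u" "\<not> core u" using deg_core by auto
    then obtain x k where "u = Pendant x k" using adj_vert[OF u(1)] by (cases u) auto
    then show "u \<in> Pendant v ` {..<cnt v}"
      using u(1) adj_sym[of v u] by (simp add: adj_Pendant)
  next
    fix u assume "u \<in> Pendant v ` {..<cnt v}"
    then obtain k where "k < cnt v" "u = Pendant v k" by blast
    then show "u \<in> {u. adj v u \<and> deg u = 1}"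
      using True adj_sym[of v u] by (simp add: adj_Pendant deg_Pendant)
  qed
  then show ?thesis by (simp add: card_image inj_on_def)
next
  case False
  then obtain x k where v: "v = Pendant x k" using assms by (cases v) auto
  have none: "{u. adj v u \<and> deg u = 1} = {}"
    using deg_core by (auto simp: v adj_Pendant)
  show ?thesis unfolding none by (simp add: v)
qed

text \<open>Degrees are preserved, hence pendant counts, hence the initial colours of core vertices
  including the tags. The crossing at tag \<open>c\<close> then pins down \<open>Node c\<close>,
  even if the two master vertices are exchanged.\<close>

lemma automorphism_fixes_nodes:
  assumes vert: "\<And>v. vert v \<Longrightarrow> vert (\<psi> v)" and inj: "inj_on \<psi> {v. vert v}"
    and adj: "\<And>v w. vert v \<Longrightarrow> vert w \<Longrightarrow> adj (\<psi> v) (\<psi> w) \<longleftrightarrow> adj v w"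
    and c: "c \<in> V" "c \<noteq> r"
  shows "\<psi> (Node c) = Node c"
proof -
  have onto: "\<psi> ` {v. vert v} = {v. vert v}"
    using vert inj finite_vert by (intro endo_inj_surj) auto
  have surj: "\<exists>v. vert v \<and> \<psi> v = w" if "vert w" for w
  proof -
    have "w \<in> \<psi> ` {v. vert v}" unfolding onto using that by simp
    then show ?thesis by auto
  qed
  have img: "{u. adj (\<psi> v) u \<and> P u} = \<psi> ` {u. adj v u \<and> P (\<psi> u)}" if "vert v" for v P
  proof (intro equalityI subsetI)
    fix u assume u: "u \<in> {u. adj (\<psi> v) u \<and> P u}"
    then have "vert u" using adj_vert by blast
    then obtain u0 where "vert u0" "\<psi> u0 = u" using surj[of u] by auto
    moreover have "adj v u0" using u adj[OF that \<open>vert u0\<close>] calculation(2) by simp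
    ultimately show "u \<in> \<psi> ` {u. adj v u \<and> P (\<psi> u)}" using u by blast
  next
    fix u assume "u \<in> \<psi> ` {u. adj v u \<and> P (\<psi> u)}"
    then obtain u0 where u0: "u = \<psi> u0" "adj v u0" "P (\<psi> u0)" by blast
    moreover have "vert u0" using u0(2) adj_vert by blast
    ultimately show "u \<in> {u. adj (\<psi> v) u \<and> P u}" using adj[OF that] by simp
  qed
  have card_img: "card {u. adj (\<psi> v) u \<and> P u} = card {u. adj v u \<and> P (\<psi> u)}" if "vert v" for v P
    unfolding img[OF that]
    by (rule card_image, rule inj_on_subset[OF inj]) (use adj_vert in blast)
  have deg: "deg (\<psi> v) = deg v" if "vert v" for v
    using card_img[OF that, of "\<lambda>_. True"] by (simp add: deg_def)
  have cnt: "cnt (\<psi> v) = cnt v" if "vert v" for v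
  proof -
    have "{u. adj v u \<and> deg (\<psi> u) = 1} = {u. adj v u \<and> deg u = 1}"
      using deg adj_vert by auto
    then show ?thesis
      using card_img[OF that, of "\<lambda>u. deg u = 1"] card_pendants[OF that] card_pendants[OF vert[OF that]]
      by simp
  qed
  have col: "colour {} (\<psi> v) = colour {} v" if "core v" for v
  proof (rule colour_of_cnt)
    have "cnt (\<psi> v) \<noteq> 0" using cnt[OF core_vert[OF that]] that by (cases v) auto
    then show "core (\<psi> v)" using vert[OF core_vert[OF that]] by (cases "\<psi> v") auto
  qed (use that cnt core_vert in auto)
  have tok: "token c c c" using c by (simp add: token_def)
  \<comment> \<open>The row end of this token pair meets \<open>Master False\<close> and its column
    end \<open>Master True\<close>. The image has the same tag and again two different master
    vertices, so its first node is \<open>c\<close>.\<close>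
  define x where "x = Row c c c True"
  define y where "y = Col c c c True"
  have cores: "core x" "core y" "core (Node c)" "core (Master b)" for b
    using tok c by (simp_all add: x_def y_def)
  obtain a b s where px: "\<psi> x = Row a b c s"
    using col[OF cores(1)] by (cases "\<psi> x") (auto simp: x_def)
  obtain d where pc: "\<psi> (Node c) = Node d"
    using col[OF cores(3)] by (cases "\<psi> (Node c)") auto
  obtain m where pm: "\<psi> (Master False) = Master m"
    using col[OF cores(4), of False] by (cases "\<psi> (Master False)") auto
  obtain m' where pm': "\<psi> (Master True) = Master m'"
    using col[OF cores(4), of True] by (cases "\<psi> (Master True)") auto
  note vs = cores[THEN core_vert]
  have "\<psi> (Master False) \<noteq> \<psi> (Master True)"
    using inj_on_eq_iff[OF inj, of "Master False" "Master True"] by simp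
  then have mm: "m' = (\<not> m)" by (auto simp: pm pm')
  have "adj (\<psi> x) (\<psi> (Node c))" "adj (\<psi> x) (\<psi> (Master False))" "adj (\<psi> x) (\<psi> y)"
    "adj (\<psi> y) (\<psi> (Master True))"
    using tok c by (simp_all add: adj vs) (simp_all add: x_def y_def adj_Row adj_Col lift.simps)
  note ad = this[unfolded px pc pm pm']
  have "a = d" "m = lift a b c s" using ad(1,2) by (auto simp: adj_Row)
  moreover have py: "\<psi> y = Col a b c s"
    using col[OF cores(2)] ad(3) by (cases "\<psi> y") (auto simp: adj_Row y_def)
  moreover have "m' = s" using ad(4) py by (auto simp: adj_Col)
  ultimately have "d = c" using mm c by (auto simp: lift.simps split: if_splits)
  then show ?thesis using pc by simp
qed

end

subsection \<open>Cell selector and sufficiency\<close>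

lemma permuted_cell:
  assumes "\<phi> permutes {..<n}"
  shows "{v. v < n \<and> perm_coloring \<phi> \<sigma> v = c} = \<phi> ` {v. v < n \<and> \<sigma> v = c}"
proof (intro equalityI subsetI)
  fix v assume "v \<in> {v. v < n \<and> perm_coloring \<phi> \<sigma> v = c}"
  then have "inv \<phi> v < n" "\<sigma> (inv \<phi> v) = c"
    using permutes_in_image[OF permutes_inv[OF assms], of v] by (simp_all add: perm_coloring_def)
  moreover have "v = \<phi> (inv \<phi> v)" using assms by (simp add: permutes_inverses)
  ultimately show "v \<in> \<phi> ` {v. v < n \<and> \<sigma> v = c}" by blast
next
  fix v assume "v \<in> \<phi> ` {v. v < n \<and> \<sigma> v = c}"
  then obtain w where w: "v = \<phi> w" "w < n" "\<sigma> w = c" by blast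
  then have "v < n" using permutes_in_image[OF assms, of w] by simp
  then show "v \<in> {v. v < n \<and> perm_coloring \<phi> \<sigma> v = c}"
    using w permutes_inverses(2)[OF assms] by (simp add: perm_coloring_def)
qed

text \<open>Colours are not moved by a permutation of the vertices, so an invariant preference among
  colours yields a cell selector.\<close>

definition large_colour :: "nat \<Rightarrow> (nat \<Rightarrow> nat) \<Rightarrow> nat \<Rightarrow> bool" where
  "large_colour n \<sigma> c \<longleftrightarrow> 1 < card {v. v < n \<and> \<sigma> v = c}"

text \<open>The least preferred colour among the non-singleton cells, or the least such colour if
  none is preferred; the fallback makes it a selector on every coloured graph.\<close>

definition selector_from ::
  "((nat \<Rightarrow> nat \<Rightarrow> bool) \<Rightarrow> (nat \<Rightarrow> nat) \<Rightarrow> nat \<Rightarrow> bool) \<Rightarrow> nat \<Rightarrow>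
   (nat \<Rightarrow> nat \<Rightarrow> bool) \<Rightarrow> (nat \<Rightarrow> nat) \<Rightarrow> nat set" where
  "selector_from Q n E \<sigma> = (if discrete n \<sigma> then {} else {v. v < n \<and> \<sigma> v =
     (LEAST c. large_colour n \<sigma> c \<and> ((\<exists>c'. large_colour n \<sigma> c' \<and> Q E \<sigma> c') \<longrightarrow> Q E \<sigma> c))})"

lemma large_colour_exists:
  assumes "\<not> discrete n \<sigma>"
  shows "\<exists>c. large_colour n \<sigma> c"
proof -
  obtain x y where xy: "x < n" "y < n" "\<sigma> x = \<sigma> y" "x \<noteq> y"
    using assms by (auto simp: discrete_def inj_on_def)
  have "card {x, y} \<le> card {v. v < n \<and> \<sigma> v = \<sigma> x}"
    using xy by (intro card_mono) auto
  then have "large_colour n \<sigma> (\<sigma> x)" using xy by (simp add: large_colour_def)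
  then show ?thesis by blast
qed

lemma cell_selector_from:
  assumes Q: "\<And>\<phi> E \<sigma> c. \<phi> permutes {..<n} \<Longrightarrow> Q E \<sigma> c \<Longrightarrow>
    Q (perm_graph \<phi> E) (perm_coloring \<phi> \<sigma>) c"
  shows "cell_selector n (selector_from Q n)"
  unfolding cell_selector_def
proof (intro allI impI, elim conjE, intro conjI allI impI)
  fix E \<sigma> \<phi> assume phi: "\<phi> permutes {..<n}"
  \<comment> \<open>The hypothesis on \<open>Q\<close> is an implication; applying it to the inverse
    permutation gives the converse.\<close>
  have undo: "perm_graph (inv \<phi>) (perm_graph \<phi> E) = E" "perm_coloring (inv \<phi>) (perm_coloring \<phi> \<sigma>) = \<sigma>"
    using phi by (simp_all add: perm_graph_comp[OF permutes_inv] perm_coloring_comp[OF permutes_inv]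
        permutes_inv_o) (simp_all add: perm_graph_def perm_coloring_def)
  have Qeq: "Q (perm_graph \<phi> E) (perm_coloring \<phi> \<sigma>) = Q E \<sigma>"
    using Q[OF phi, of E \<sigma>] Q[OF permutes_inv[OF phi], of "perm_graph \<phi> E" "perm_coloring \<phi> \<sigma>"]
    unfolding undo by blast
  have Leq: "large_colour n (perm_coloring \<phi> \<sigma>) = large_colour n \<sigma>"
    using permutes_inj_on[OF phi]
    by (simp add: fun_eq_iff large_colour_def permuted_cell[OF phi] card_image)
  have Deq: "discrete n (perm_coloring \<phi> \<sigma>) = discrete n \<sigma>"
  proof -
    have im: "inv \<phi> ` {..<n} = {..<n}" using permutes_image[OF permutes_inv[OF phi]] .
    have "inj_on (inv \<phi>) {..<n}" using permutes_inj_on[OF permutes_inv[OF phi]] .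
    then show ?thesis
      unfolding discrete_def perm_coloring_def
      using comp_inj_on_iff[of "inv \<phi>" "{..<n}" \<sigma>] im by simp
  qed
  show "selector_from Q n (perm_graph \<phi> E) (perm_coloring \<phi> \<sigma>) = \<phi> ` selector_from Q n E \<sigma>"
    unfolding selector_from_def Qeq Leq Deq permuted_cell[OF phi] by simp
next
  fix E \<sigma> assume "discrete n \<sigma>"
  then show "selector_from Q n E \<sigma> = {}" by (simp add: selector_from_def)
next
  fix E \<sigma> assume nd: "\<not> discrete n \<sigma>"
  define P where "P c \<longleftrightarrow> large_colour n \<sigma> c \<and> ((\<exists>c'. large_colour n \<sigma> c' \<and> Q E \<sigma> c') \<longrightarrow> Q E \<sigma> c)" for c
  have "\<exists>c. P c" using large_colour_exists[OF nd] unfolding P_def by blast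
  then have "P (LEAST c. P c)" by (rule LeastI_ex)
  then have large: "large_colour n \<sigma> (LEAST c. P c)" by (simp add: P_def)
  have sel: "selector_from Q n E \<sigma> = {v. v < n \<and> \<sigma> v = (LEAST c. P c)}"
    using nd by (simp add: selector_from_def P_def)
  show "1 < card (selector_from Q n E \<sigma>)" using large by (simp add: sel large_colour_def)
  then have "selector_from Q n E \<sigma> \<noteq> {}" by force
  then obtain v where "v < n" "\<sigma> v = (LEAST c. P c)" unfolding sel by blast
  then show "selector_from Q n E \<sigma> \<in> cells n \<sigma>"
    unfolding sel cells_def by force
qed

fun node_of :: "'a vertex \<Rightarrow> 'a" where
  "node_of (Node c) = c"
| "node_of _ = undefined"

section \<open>Paths from the root of the tree\<close>

context tree_gadget
begin

text \<open>The root is left out of the list, so that a path translates entry by entry into a node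
  sequence of the IR-tree.\<close>

inductive tpath :: "'a \<Rightarrow> 'a list \<Rightarrow> bool" where
  root: "tpath r []"
| child: "tpath u p \<Longrightarrow> x \<in> ch u \<Longrightarrow> tpath x (p @ [x])"

lemma tpath_in: "tpath x p \<Longrightarrow> x \<in> V"
  by (induction rule: tpath.induct) (auto simp: root_in in_ch)

lemma tpath_exists:
  assumes "x \<in> V"
  shows "\<exists>p. tpath x p"
proof -
  obtain k where "(par ^^ k) x = r" using tree assms by (auto simp: rooted_tree_def)
  then show ?thesis using assms
  proof (induction k arbitrary: x)
    case 0
    then show ?case using tpath.root by auto
  next
    case (Suc k)
    show ?case
    proof (cases "x = r")
      case True
      then show ?thesis using tpath.root by blast
    next
      case False
      have "(par ^^ k) (par x) = r" using Suc.prems(1) by (simp add: funpow_swap1)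
      then obtain p where "tpath (par x) p" using Suc.IH par_in Suc.prems(2) False by blast
      then show ?thesis using False Suc.prems(2) by (blast intro: tpath.child in_ch[THEN iffD2])
    qed
  qed
qed

lemma tpath_node: "tpath x p \<Longrightarrow> x = (if p = [] then r else last p)"
  by (induction rule: tpath.induct) auto

lemma tpath_unique: "tpath x p \<Longrightarrow> tpath x q \<Longrightarrow> p = q"
proof (induction arbitrary: q rule: tpath.induct)
  case root
  then show ?case by (cases rule: tpath.cases) (auto simp: in_ch)
next
  case (child u p x)
  from child.prems show ?case
  proof (cases rule: tpath.cases)
    case root
    then show ?thesis using child.hyps by (simp add: in_ch)
  next
    case (child u' q')
    then have "u' = u" using \<open>x \<in> ch u\<close> by (simp add: in_ch)
    then show ?thesis using child child.IH by blast
  qed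
qed

lemma tpath_set: "tpath x p \<Longrightarrow> c \<in> set p \<Longrightarrow> c \<in> V \<and> c \<noteq> r"
  by (induction rule: tpath.induct) (auto simp: in_ch)

lemma tpath_inner: "tpath x p \<Longrightarrow> c \<in> set p \<Longrightarrow> c = x \<or> \<not> is_leaf V r par c"
  by (induction rule: tpath.induct) (auto simp: is_leaf_def)

lemma tpath_take: "tpath x p \<Longrightarrow> i < length p \<Longrightarrow> \<exists>u. tpath u (take i p) \<and> p ! i \<in> ch u"
proof (induction rule: tpath.induct)
  case (child u p x)
  then show ?case by (cases "i < length p") (auto simp: nth_append less_Suc_eq)
qed simp

text \<open>A path is determined by its end, so equal parents force equal prefixes and thus equal
  positions; a path meets every family of siblings at most once.\<close>

lemma tpath_parent_inj:
  assumes "tpath x p" "i < length p" "j < length p" "par (p ! i) = par (p ! j)"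
  shows "i = j"
proof -
  obtain u u' where "tpath u (take i p)" "p ! i \<in> ch u" "tpath u' (take j p)" "p ! j \<in> ch u'"
    using tpath_take assms by blast
  then have "take i p = take j p" using assms(4) tpath_unique by (auto simp: in_ch)
  then have "length (take i p) = length (take j p)" by simp
  then show ?thesis using assms by simp
qed

lemma tpath_siblings: "tpath x p \<Longrightarrow> c \<in> set p \<Longrightarrow> d \<in> set p \<Longrightarrow> par c = par d \<Longrightarrow> c = d"
  by (metis in_set_conv_nth tpath_parent_inj)

lemma tpath_distinct: "tpath x p \<Longrightarrow> distinct p"
  by (metis distinct_conv_nth tpath_parent_inj)

lemma root_inner: "\<not> is_leaf V r par r"
proof -
  obtain c where c: "c \<in> V" "c \<noteq> r" using exists_node by blast
  then obtain p where p: "tpath c p" using tpath_exists by blast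
  then have "p \<noteq> []" using tpath_node c by force
  then obtain u where "tpath u []" "p ! 0 \<in> ch u" using tpath_take[OF p, of 0] by auto
  then show ?thesis using tpath_node[of u "[]"] by (auto simp: is_leaf_def)
qed

end

section \<open>Transfer of the gadget graph to the vertex set \<open>{..<n}\<close>\<close>

locale encoded_gadget = tree_gadget V r par idx D
  for V :: "'a set" and r par idx D +
  fixes Ref :: "nat \<Rightarrow> (nat \<Rightarrow> nat \<Rightarrow> bool) \<Rightarrow> (nat \<Rightarrow> nat) \<Rightarrow> nat list \<Rightarrow> (nat \<Rightarrow> nat)"
    and n :: nat and h :: "nat \<Rightarrow> 'a vertex" and \<pi> :: "nat \<Rightarrow> nat"
  assumes refinement_Ref: "refinement Ref"
    and irreducible: "irreducible_tree V r par"
    and h: "bij_betw h {..<n} {v. vert v}"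
    and \<pi>_coloring: "is_coloring n \<pi>"
    and \<pi>_kernel: "\<And>x y. x < n \<Longrightarrow> y < n \<Longrightarrow> \<pi> x = \<pi> y \<longleftrightarrow> colour {} (h x) = colour {} (h y)"
begin

definition E :: "nat \<Rightarrow> nat \<Rightarrow> bool" where
  "E x y \<longleftrightarrow> x < n \<and> y < n \<and> adj (h x) (h y)"

definition g :: "'a vertex \<Rightarrow> nat" where
  "g = inv_into {..<n} h"

lemma gh: "x < n \<Longrightarrow> g (h x) = x"
  using h by (simp add: g_def bij_betw_def inv_into_f_f)

lemma hg: "vert v \<Longrightarrow> h (g v) = v"
  using h by (simp add: g_def bij_betw_def f_inv_into_f)

lemma h_vert: "x < n \<Longrightarrow> vert (h x)"
  using h by (auto simp: bij_betw_def)

lemma g_less: "vert v \<Longrightarrow> g v < n"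
  using bij_betw_inv_into[OF h] by (auto simp: g_def bij_betw_def)

lemma is_graph_E: "is_graph n E"
  using adj_sym adj_irrefl by (auto simp: is_graph_def E_def)

sublocale refined_graph Ref n E \<pi>
  using refinement_Ref is_graph_E \<pi>_coloring by unfold_locales

lemma card_E:
  assumes "x < n"
  shows "card {u. u < n \<and> E x u \<and> P u} = card {w. adj (h x) w \<and> P (g w)}"
proof (rule bij_betw_same_card)
  show "bij_betw h {u. u < n \<and> E x u \<and> P u} {w. adj (h x) w \<and> P (g w)}"
    by (rule bij_betw_byWitness[where f' = g])
      (use assms gh hg g_less adj_vert in \<open>auto simp: E_def\<close>)
qed

lemma equitable_if_stable:
  assumes st: "stable \<rho>"
    and ker: "\<And>x y. x < n \<Longrightarrow> y < n \<Longrightarrow> \<sigma> x = \<sigma> y \<longleftrightarrow> \<rho> (h x) = \<rho> (h y)"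
  shows "equitable n E \<sigma>"
  unfolding equitable_def
proof (intro allI impI)
  fix v w c assume vw: "v < n" "w < n" "\<sigma> v = \<sigma> w"
  then have eq: "\<rho> (h v) = \<rho> (h w)" using ker by blast
  show "card {u. u < n \<and> E v u \<and> \<sigma> u = c} = card {u. u < n \<and> E w u \<and> \<sigma> u = c}"
  proof (cases "\<exists>z<n. \<sigma> z = c")
    case True
    then obtain z where z: "z < n" "\<sigma> z = c" by blast
    have sets: "{y. adj (h x) y \<and> \<sigma> (g y) = c} = {y. adj (h x) y \<and> \<rho> y = \<rho> (h z)}" for x
      using ker[OF g_less z(1)] z(2) hg adj_vert by auto
    show ?thesis
      unfolding card_E[OF vw(1)] card_E[OF vw(2)] sets
      using st h_vert vw(1,2) eq unfolding stable_def by blast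
  next
    case False
    then have sets: "{u. u < n \<and> E x u \<and> \<sigma> u = c} = {}" for x by blast
    show ?thesis unfolding sets by simp
  qed
qed

lemma stable_if_equitable:
  assumes "equitable n E \<sigma>"
  shows "stable (\<lambda>v. \<sigma> (g v))"
  unfolding stable_def
proof (intro allI impI, elim conjE)
  fix v w k assume v: "vert v" and w: "vert w" and eq: "\<sigma> (g v) = \<sigma> (g w)"
  have "card {u. u < n \<and> E (g v) u \<and> \<sigma> u = k} = card {u. u < n \<and> E (g w) u \<and> \<sigma> u = k}"
    using assms g_less[OF v] g_less[OF w] eq unfolding equitable_def by blast
  then show "card {u. adj v u \<and> \<sigma> (g u) = k} = card {u. adj w u \<and> \<sigma> (g u) = k}"
    unfolding card_E[OF g_less[OF v]] card_E[OF g_less[OF w]] hg[OF v] hg[OF w] .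
qed

definition gN :: "'a \<Rightarrow> nat" where "gN c = g (Node c)"

lemma gN: "c \<in> V \<Longrightarrow> c \<noteq> r \<Longrightarrow> gN c < n \<and> h (gN c) = Node c"
  using g_less[of "Node c"] hg[of "Node c"] by (simp add: gN_def)

lemma gN_inj: "c \<in> V \<Longrightarrow> c \<noteq> r \<Longrightarrow> d \<in> V \<Longrightarrow> d \<noteq> r \<Longrightarrow> gN c = gN d \<longleftrightarrow> c = d"
  using gN by (metis vertex.inject(2))

lemma valid_path:
  assumes "tpath x p"
  shows "valid (map gN p)"
proof -
  have "inj_on gN (set p)"
    using gN_inj tpath_set[OF assms] by (auto simp: inj_on_def)
  then show ?thesis
    using gN tpath_set[OF assms] tpath_distinct[OF assms]
    by (auto simp: valid_def distinct_map)
qed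

text \<open>The initial colour confines the cell to the children of \<open>x\<close>. Conversely,
  \<open>colour (set p)\<close> is stable, since the path contains no leaf and no two siblings; the
  coarsest refinement therefore cannot separate these children.\<close>

lemma cell_inner:
  assumes p: "tpath x p" and y: "y \<in> ch x"
  shows "{v. v < n \<and> R (map gN p) v = R (map gN p) (gN y)} = gN ` ch x"
proof -
  note val = valid_path[OF p]
  have yV: "y \<in> V" "y \<noteq> r" "par y = x" using y by (simp_all add: in_ch)
  have inner: "\<not> is_leaf V r par c" if "c \<in> set p" for c
    using tpath_inner[OF p that] y by (auto simp: is_leaf_def)
  have notin: "c \<notin> set p" if "c \<in> ch x" for c
  proof
    assume "c \<in> set p"
    moreover have "tpath c (p @ [c])" using p that by (rule tpath.child)
    ultimately show False using tpath_distinct by fastforce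
  qed
  obtain \<sigma> where s: "is_coloring n \<sigma>"
    "\<forall>v<n. \<forall>w<n. \<sigma> v = \<sigma> w \<longleftrightarrow> colour (set p) (h v) = colour (set p) (h w)"
    using is_coloring_exists[of n "\<lambda>v. colour (set p) (h v)"] by blast
  have st: "stable (colour (set p))"
    by (rule stable_colour[OF inner tpath_siblings[OF p]])
  have forget: "colour {} v = colour {} w" if "colour A v = colour A w" for v w A
    using that
  proof (induction v arbitrary: w)
    case (Pendant v k)
    from Pendant.prems obtain x where x: "w = Pendant x k" "colour A v = colour A x"
      by (cases w) auto
    show ?case using Pendant.IH[OF x(2)] x(1) by simp
  qed (case_tac w; auto)+
  have "finer n \<sigma> (R (map gN p))"
  proof (rule R_coarsest[OF val s(1)])
    show "equitable n E \<sigma>" by (rule equitable_if_stable[OF st]) (use s(2) in blast)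
    show "finer n \<sigma> \<pi>" unfolding finer_def using s(2) \<pi>_kernel forget by blast
    fix v w assume v: "v \<in> set (map gN p)" and w: "w < n" "\<sigma> w = \<sigma> v"
    then obtain c where c: "c \<in> set p" "v = gN c" by auto
    have cV: "c \<in> V" "c \<noteq> r" using tpath_set[OF p c(1)] by simp_all
    have "v < n" "h v = Node c" using gN[OF cV] c(2) by simp_all
    then have "colour (set p) (h w) = colour (set p) (Node c)" using s(2) w by metis
    then have "colour (set p) (h w) = CNode (par c) True" using c(1) by simp
    then obtain d where d: "h w = Node d" "par d = par c" "d \<in> set p"
      by (cases "h w") auto
    then have "d = c" using tpath_siblings[OF p] c by blast
    then show "w = v" using gh[OF w(1)] d c by (simp add: gN_def)
  qed
  then have same: "R (map gN p) (gN c) = R (map gN p) (gN y)" if "c \<in> ch x" for c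
  proof -
    have "c \<in> V" "c \<noteq> r" "par c = x" using that by (simp_all add: in_ch)
    then have "\<sigma> (gN c) = \<sigma> (gN y)"
      using s(2) gN yV notin[OF that] notin[OF y] by simp
    then show ?thesis
      using \<open>finer n \<sigma> (R (map gN p))\<close> gN \<open>c \<in> V\<close> \<open>c \<noteq> r\<close> yV unfolding finer_def by blast
  qed
  show ?thesis
  proof (intro equalityI subsetI)
    fix v assume v: "v \<in> {v. v < n \<and> R (map gN p) v = R (map gN p) (gN y)}"
    then have "\<pi> v = \<pi> (gN y)"
      using R_finer[OF val] gN[OF yV(1,2)] unfolding finer_def by blast
    then have col: "colour {} (h v) = CNode x False"
      using \<pi>_kernel[of v "gN y"] v gN[OF yV(1,2)] yV by simp
    then obtain c where c: "h v = Node c" "par c = x"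
      by (cases "h v") auto
    then have "c \<in> ch x" using h_vert[of v] v by (simp add: in_ch)
    moreover have "v = gN c" using gh[of v] c v by (simp add: gN_def)
    ultimately show "v \<in> gN ` ch x" by blast
  next
    fix v assume "v \<in> gN ` ch x"
    then show "v \<in> {v. v < n \<and> R (map gN p) v = R (map gN p) (gN y)}"
      using same gN by (auto simp: in_ch)
  qed
qed

text \<open>The leaf \<open>x\<close> is the last entry of its path and hence isolated, so
  \<open>stable_discrete\<close> applies to the refinement.\<close>

lemma discrete_leaf:
  assumes p: "tpath x p" and leaf: "is_leaf V r par x"
  shows "discrete n (R (map gN p))"
proof -
  note val = valid_path[OF p]
  have "x \<noteq> r" using leaf root_inner by blast
  then have xV: "x \<in> V" "x \<noteq> r" "x \<in> set p"
    using tpath_in[OF p] tpath_node[OF p] by (auto split: if_splits)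
  let ?\<rho> = "\<lambda>v. R (map gN p) (g v)"
  have inj: "inj_on ?\<rho> {v. vert v}"
  proof (rule stable_discrete)
    show "stable ?\<rho>" by (rule stable_if_equitable[OF R_equitable[OF val]])
    show "colour {} v = colour {} w" if "vert v" "vert w" "?\<rho> v = ?\<rho> w" for v w
    proof -
      have "\<pi> (g v) = \<pi> (g w)"
        using R_finer[OF val] g_less that unfolding finer_def by blast
      then show ?thesis using \<pi>_kernel g_less hg that by simp
    qed
    show "w = Node x" if "vert w" "?\<rho> w = ?\<rho> (Node x)" for w
    proof -
      have "g w = g (Node x)"
        using R_isolates[OF val, of "gN x" "g w"] xV(3) g_less[OF that(1)] that(2)
        unfolding gN_def by simp
      then have "h (g w) = h (g (Node x))" by (rule arg_cong)
      moreover have "vert (Node x)" using xV by simp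
      ultimately show ?thesis unfolding hg[OF that(1)] by (simp only: hg)
    qed
  qed (use xV leaf in auto)
  show ?thesis
    unfolding discrete_def
  proof (rule inj_onI)
    fix a b assume ab: "a \<in> {..<n}" "b \<in> {..<n}" "R (map gN p) a = R (map gN p) b"
    then have l: "a < n" "b < n" by simp_all
    have "h a = h b"
      by (rule inj_onD[OF inj]) (use l ab(3) in \<open>simp_all add: gh h_vert\<close>)
    then have "g (h a) = g (h b)" by (rule arg_cong)
    then show "a = b" unfolding gh[OF l(1)] gh[OF l(2)] .
  qed
qed

lemma automorphism_fixes:
  assumes phi: "\<phi> permutes {..<n}" and E: "E = perm_graph \<phi> E" and c: "c \<in> V" "c \<noteq> r"
  shows "\<phi> (gN c) = gN c"
proof -
  define \<psi> where "\<psi> v = h (\<phi> (g v))" for v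
  have less: "\<phi> x < n \<longleftrightarrow> x < n" for x using permutes_in_image[OF phi] by simp
  have E': "E (\<phi> x) (\<phi> y) \<longleftrightarrow> E x y" for x y
    by (subst E) (simp add: perm_graph_def permutes_inverses[OF phi])
  have "\<psi> (Node c) = Node c"
  proof (rule automorphism_fixes_nodes)
    show "vert (\<psi> v)" if "vert v" for v
      using that by (simp add: \<psi>_def h_vert less g_less)
    show "inj_on \<psi> {v. vert v}"
    proof (rule inj_onI)
      fix v w assume vw: "v \<in> {v. vert v}" "w \<in> {v. vert v}" "\<psi> v = \<psi> w"
      have l: "\<phi> (g v) < n" "\<phi> (g w) < n" using vw(1,2) less g_less by simp_all
      have "g (\<psi> v) = g (\<psi> w)" using vw(3) by simp
      then have "\<phi> (g v) = \<phi> (g w)" unfolding \<psi>_def gh[OF l(1)] gh[OF l(2)] .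
      then have "g v = g w" using permutes_inj[OF phi] by (simp add: inj_eq)
      then have "h (g v) = h (g w)" by (rule arg_cong)
      then show "v = w" using vw(1,2) by (simp only: mem_Collect_eq hg)
    qed
    show "adj (\<psi> v) (\<psi> w) \<longleftrightarrow> adj v w" if "vert v" "vert w" for v w
      using E'[of "g v" "g w"] that by (simp add: \<psi>_def E_def less g_less hg)
  qed (use c in auto)
  then have "g (h (\<phi> (g (Node c)))) = g (Node c)" by (simp add: \<psi>_def)
  then show ?thesis using gh less g_less[of "Node c"] c by (simp add: gN_def)
qed

text \<open>The individualization colours make \<open>p\<close> a prefix of \<open>q\<close>. If it
  were proper, the next entry of \<open>q\<close> would carry a colour of its own, although after
  \<open>p\<close> it shares its cell with a sibling, which exists by irreducibility.\<close>

lemma paths_agree: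
  assumes p: "tpath x p" and q: "tpath x' q" and y: "y \<in> ch x" and le: "length p \<le> length q"
    and eq: "\<And>c. c \<in> V \<Longrightarrow> c \<noteq> r \<Longrightarrow> R (map gN p) (gN c) = R (map gN q) (gN c)"
  shows "p = q"
proof -
  have pos: "c = q ! i"
    if c: "c \<in> V" "c \<noteq> r" and i: "i < length q" "R (map gN p) (gN c) = Suc i" for c i
  proof -
    have "gN c = map gN q ! i"
      using R_eq_Suc[OF valid_path[OF q], of i "gN c"] c i eq[OF c] gN by simp
    moreover have "q ! i \<in> V" "q ! i \<noteq> r" using tpath_set[OF q] i by simp_all
    ultimately show ?thesis using gN_inj c i by simp
  qed
  have "p ! i = q ! i" if i: "i < length p" for i
    using pos[of "p ! i" i] R_nth[OF valid_path[OF p], of i] tpath_set[OF p, of "p ! i"] i le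
    by simp
  then have pre: "p = take (length p) q" using le by (auto intro: nth_equalityI)
  show ?thesis
  proof (cases "length p = length q")
    case True
    then show ?thesis using pre by simp
  next
    case False
    then have len: "length p < length q" using le by simp
    obtain u where u: "tpath u (take (length p) q)" "q ! length p \<in> ch u"
      using tpath_take[OF q len] by blast
    have "u = x" using tpath_node[OF u(1)] tpath_node[OF p] pre by simp
    then have z: "q ! length p \<in> ch x" using u by simp
    have "card (ch x) \<noteq> 1" using irreducible tpath_in[OF p] by (simp add: irreducible_tree_def)
    then have "ch x \<noteq> {q ! length p}" by auto
    then obtain z' where z': "z' \<in> ch x" "z' \<noteq> q ! length p" using z by blast
    have "R (map gN p) (gN z') = R (map gN p) (gN (q ! length p))"
      using cell_inner[OF p z] z' by blast
    also have "\<dots> = Suc (length p)"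
      using eq[of "q ! length p"] z R_nth[OF valid_path[OF q], of "length p"] len by (simp add: in_ch)
    finally have "z' = q ! length p" using pos[of z' "length p"] z' len by (simp add: in_ch)
    then show ?thesis using z' by simp
  qed
qed

section \<open>The selector that follows the tree\<close>

text \<open>Recognises an isomorphic copy of the graph refined along some tree path and prefers the
  colour of the children. Quantifying over \<open>\<phi>\<close> builds in the invariance.\<close>

definition preferred :: "(nat \<Rightarrow> nat \<Rightarrow> bool) \<Rightarrow> (nat \<Rightarrow> nat) \<Rightarrow> nat \<Rightarrow> bool" where
  "preferred E' \<sigma> c \<longleftrightarrow> (\<exists>\<phi> x p y. \<phi> permutes {..<n} \<and> tpath x p \<and> y \<in> ch x \<and>
     E' = perm_graph \<phi> E \<and> \<sigma> = perm_coloring \<phi> (R (map gN p)) \<and> c = R (map gN p) (gN y))"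

abbreviation sel where "sel \<equiv> selector_from preferred n"

lemma cell_selector_sel: "cell_selector n sel"
proof (rule cell_selector_from)
  fix \<psi> E' \<sigma> c assume psi: "\<psi> permutes {..<n}" and "preferred E' \<sigma> c"
  then obtain \<phi> x p y where *: "\<phi> permutes {..<n}" "tpath x p" "y \<in> ch x"
     "E' = perm_graph \<phi> E" "\<sigma> = perm_coloring \<phi> (R (map gN p))" "c = R (map gN p) (gN y)"
    unfolding preferred_def by blast
  have "perm_graph \<psi> E' = perm_graph (\<psi> \<circ> \<phi>) E"
    "perm_coloring \<psi> \<sigma> = perm_coloring (\<psi> \<circ> \<phi>) (R (map gN p))"
    using perm_graph_comp[OF psi *(1)] perm_coloring_comp[OF psi *(1)] * by simp_all
  then show "preferred (perm_graph \<psi> E') (perm_coloring \<psi> \<sigma>) c"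
    unfolding preferred_def using permutes_compose[OF *(1) psi] *(2,3,6) by blast
qed

text \<open>A second witness comes with an automorphism of the graph. It fixes all tree nodes, so
  both refinements agree on them and \<open>paths_agree\<close> identifies the two paths.\<close>

lemma preferred_unique:
  assumes p: "tpath x p" and y: "y \<in> ch x" and pref: "preferred E (R (map gN p)) c"
  shows "c = R (map gN p) (gN y)"
proof -
  obtain \<phi> x' q y' where *: "\<phi> permutes {..<n}" "tpath x' q" "y' \<in> ch x'"
     "E = perm_graph \<phi> E" "R (map gN p) = perm_coloring \<phi> (R (map gN q))" "c = R (map gN q) (gN y')"
    using pref unfolding preferred_def by blast
  have eq: "R (map gN p) (gN a) = R (map gN q) (gN a)" if "a \<in> V" "a \<noteq> r" for a
  proof -
    have "inv \<phi> (gN a) = gN a"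
      using automorphism_fixes[OF *(1,4) that] permutes_inv_eq[OF *(1)] by simp
    then show ?thesis by (simp add: *(5) perm_coloring_def)
  qed
  have "p = q"
  proof (cases "length p \<le> length q")
    case True
    then show ?thesis using paths_agree[OF p *(2) y _ eq] by simp
  next
    case False
    then show ?thesis using paths_agree[OF *(2) p *(3) _ eq[symmetric]] by simp
  qed
  then have "x' = x" using tpath_node[OF p] tpath_node[OF *(2)] by simp
  then have "gN y' \<in> {v. v < n \<and> R (map gN p) v = R (map gN p) (gN y)}"
    unfolding cell_inner[OF p y] using *(3) by simp
  then show ?thesis using *(6) \<open>p = q\<close> by simp
qed

lemma sel_path:
  assumes p: "tpath x p"
  shows "sel E (R (map gN p)) = gN ` ch x"
proof (cases "is_leaf V r par x")
  case True
  then show ?thesis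
    using discrete_leaf[OF p True] by (simp add: selector_from_def is_leaf_def)
next
  case False
  then obtain y where y: "y \<in> ch x" by (auto simp: is_leaf_def)
  let ?\<rho> = "R (map gN p)"
  have "card (ch x) \<noteq> 0" "card (ch x) \<noteq> 1"
    using y finite_ch irreducible tpath_in[OF p] by (auto simp: irreducible_tree_def)
  moreover have inj: "inj_on gN (ch x)" using gN_inj by (auto simp: inj_on_def in_ch)
  ultimately have card: "1 < card {v. v < n \<and> ?\<rho> v = ?\<rho> (gN y)}"
    unfolding cell_inner[OF p y] by (simp add: card_image)
  then have large: "large_colour n ?\<rho> (?\<rho> (gN y))" by (simp add: large_colour_def)
  have nd: "\<not> discrete n ?\<rho>"
  proof
    assume "discrete n ?\<rho>"
    then have "{v. v < n \<and> ?\<rho> v = ?\<rho> (gN y)} \<subseteq> {gN y}"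
      using y gN by (auto simp: discrete_def inj_on_def in_ch)
    then have "card {v. v < n \<and> ?\<rho> v = ?\<rho> (gN y)} \<le> 1"
      using card_mono[of "{gN y}"] by simp
    then show False using card by simp
  qed
  have "preferred E ?\<rho> (?\<rho> (gN y))"
    unfolding preferred_def
    by (rule exI[of _ id], rule exI[of _ x], rule exI[of _ p], rule exI[of _ y])
      (use p y in \<open>simp add: permutes_id perm_graph_def perm_coloring_def\<close>)
  then have only: "large_colour n ?\<rho> c \<and>
      ((\<exists>c'. large_colour n ?\<rho> c' \<and> preferred E ?\<rho> c') \<longrightarrow> preferred E ?\<rho> c)
      \<longleftrightarrow> c = ?\<rho> (gN y)" for c
    using large preferred_unique[OF p y] by blast
  have "(LEAST c. c = ?\<rho> (gN y)) = ?\<rho> (gN y)"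
    by (rule Least_equality) simp_all
  then show ?thesis
    unfolding selector_from_def only using nd by (simp add: cell_inner[OF p y])
qed

lemma ir_nodes_eq: "ir_nodes (Ref n) sel E \<pi> = map gN ` {p. \<exists>x. tpath x p}"
proof (intro equalityI subsetI)
  fix \<nu> assume "\<nu> \<in> ir_nodes (Ref n) sel E \<pi>"
  then show "\<nu> \<in> map gN ` {p. \<exists>x. tpath x p}"
  proof induction
    case root
    then show ?case using tpath.root by force
  next
    case (child \<nu> v)
    then obtain p x where p: "\<nu> = map gN p" "tpath x p" by blast
    then obtain y where "y \<in> ch x" "v = gN y" using child(2) sel_path by auto
    then have "tpath y (p @ [y])" "\<nu> @ [v] = map gN (p @ [y])" using p tpath.child by auto
    then show ?case by blast
  qed
next
  fix \<nu> assume "\<nu> \<in> map gN ` {p. \<exists>x. tpath x p}"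
  then obtain x p where "tpath x p" "\<nu> = map gN p" by blast
  then show "\<nu> \<in> ir_nodes (Ref n) sel E \<pi>"
  proof (induction arbitrary: \<nu> rule: tpath.induct)
    case root
    then show ?case by (simp add: ir_nodes.root)
  next
    case (child u p x)
    then have "gN x \<in> sel E (R (map gN p))" using sel_path by simp
    then show ?case using child by (simp add: ir_nodes.child)
  qed
qed

lemma is_IR_tree: "is_IR_tree Ref V r par"
proof -
  \<comment> \<open>The inverse of sending a tree node to its path; the root has no vertex of its
    own and corresponds to the empty sequence.\<close>
  define f where "f \<nu> = (if \<nu> = [] then r else node_of (h (last \<nu>)))" for \<nu>
  have f: "f (map gN p) = x" if "tpath x p" for x p
  proof (cases "p = []")
    case True
    then show ?thesis using tpath_node[OF that] by (simp add: f_def)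
  next
    case False
    then have "x = last p" using tpath_node[OF that] by simp
    moreover have "x \<in> V" "x \<noteq> r" using tpath_set[OF that, of "last p"] False calculation by auto
    ultimately show ?thesis using False gN by (simp add: f_def last_map)
  qed
  have "bij_betw f (ir_nodes (Ref n) sel E \<pi>) V"
    unfolding bij_betw_def
  proof
    show "inj_on f (ir_nodes (Ref n) sel E \<pi>)"
      unfolding ir_nodes_eq by (rule inj_onI) (use f tpath_unique in fastforce)
    show "f ` ir_nodes (Ref n) sel E \<pi> = V"
    proof (intro equalityI subsetI)
      fix x assume "x \<in> V"
      then obtain p where "tpath x p" using tpath_exists by blast
      then show "x \<in> f ` ir_nodes (Ref n) sel E \<pi>"
        unfolding ir_nodes_eq using f by force
    qed (use f tpath_in in \<open>auto simp: ir_nodes_eq\<close>)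
  qed
  moreover have "f [] = r" by (simp add: f_def)
  moreover have "par (f \<nu>) = f (butlast \<nu>)" if nu: "\<nu> \<in> ir_nodes (Ref n) sel E \<pi> - {[]}" for \<nu>
  proof -
    obtain x p where p: "tpath x p" "\<nu> = map gN p" "p \<noteq> []" using nu by (auto simp: ir_nodes_eq)
    from p(1) show ?thesis
    proof (cases rule: tpath.cases)
      case (child u q)
      then show ?thesis
        using f[OF p(1)] f[of u q] p by (simp add: in_ch)
    qed (use p in simp)
  qed
  ultimately have "rooted_tree_iso (ir_nodes (Ref n) sel E \<pi>) [] butlast V r par"
    unfolding rooted_tree_iso_def by blast
  then show ?thesis
    unfolding is_IR_tree_def using is_graph_E \<pi>_coloring cell_selector_sel by blast
qed

end

section \<open>The one-node tree and the assembly of both directions\<close>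

text \<open>The gadget graph requires a node besides the root; here the graph without vertices
  serves instead.\<close>

lemma is_IR_tree_singleton: "is_IR_tree Ref {r} r par"
proof -
  define Sel :: "(nat \<Rightarrow> nat \<Rightarrow> bool) \<Rightarrow> (nat \<Rightarrow> nat) \<Rightarrow> nat set" where "Sel = (\<lambda>_ _. {})"
  have "is_graph 0 (\<lambda>_ _. False)" by (simp add: is_graph_def)
  moreover have "is_coloring 0 (\<lambda>_. 0)" by (auto simp: is_coloring_def)
  moreover have "cell_selector 0 Sel"
    by (simp add: cell_selector_def Sel_def discrete_def)
  moreover have "ir_nodes (Ref 0) Sel (\<lambda>_ _. False) (\<lambda>_. 0) = {[]}"
  proof -
    have "\<nu> = []" if "\<nu> \<in> ir_nodes (Ref 0) Sel (\<lambda>_ _. False) (\<lambda>_. 0)" for \<nu>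
      using that by (induction) (simp_all add: Sel_def)
    then show ?thesis using ir_nodes.root by blast
  qed
  then have "rooted_tree_iso (ir_nodes (Ref 0) Sel (\<lambda>_ _. False) (\<lambda>_. 0)) [] butlast {r} r par"
    by (auto simp: rooted_tree_iso_def bij_betw_def)
  ultimately show ?thesis unfolding is_IR_tree_def by blast
qed

lemma IR_tree_if_leaf_condition:
  assumes Ref: "refinement Ref" and tree: "rooted_tree V r par" and irr: "irreducible_tree V r par"
    and cond: "\<And>u. u \<in> V \<Longrightarrow> card (children V r par u) = 2 \<Longrightarrow>
      card {c \<in> children V r par u. is_leaf V r par c} \<noteq> 1"
  shows "is_IR_tree Ref V r par"
proof (cases "V = {r}")
  case True
  then show ?thesis using is_IR_tree_singleton by simp
next
  case False
  have fin: "finite V" using tree by (simp add: rooted_tree_def)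
  obtain idx :: "'a \<Rightarrow> nat" where idx: "inj_on idx V"
    using finite_imp_inj_to_nat_seg[OF fin] by blast
  have "\<exists>D. balanced_matrix (children V r par u) {c \<in> children V r par u. is_leaf V r par c} D"
    if "u \<in> V" for u
    using fin irr cond[OF that] that
    by (intro balanced_matrix_exists) (auto simp: irreducible_tree_def children_def)
  then obtain Du where Du: "\<And>u. u \<in> V \<Longrightarrow>
      balanced_matrix (children V r par u) {c \<in> children V r par u. is_leaf V r par c} (Du u)"
    by metis
  \<comment> \<open>The matrices of the different sibling families are glued along the parent of the
    first index; the default 0 keeps every entry in \<open>{-1, 0, 1}\<close>.\<close>
  define D where "D c d = (if par c \<in> V then Du (par c) c d else 0)" for c d
  have "balanced_matrix (children V r par u) {c. is_leaf V r par c} D" if u: "u \<in> V" for u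
  proof -
    have D: "D c d = Du u c d" if "c \<in> children V r par u" for c d
      using that u by (simp add: D_def children_def)
    have range: "D c d \<in> {-1, 0, 1}" for c d
      using Du[of "par c"] by (simp add: D_def balanced_matrix_def)
    show ?thesis
      using Du[OF u] range unfolding balanced_matrix_def by (simp add: D)
  qed
  then interpret tree_gadget V r par idx D
    using tree False idx by unfold_locales
  obtain h where h: "bij_betw h {..<card {v. vert v}} {v. vert v}"
    using ex_bij_betw_nat_finite[OF finite_vert] by (auto simp: atLeast0LessThan)
  obtain \<pi> where "is_coloring (card {v. vert v}) \<pi>"
    "\<forall>x<card {v. vert v}. \<forall>y<card {v. vert v}. \<pi> x = \<pi> y \<longleftrightarrow> colour {} (h x) = colour {} (h y)"
    using is_coloring_exists[of "card {v. vert v}" "\<lambda>x. colour {} (h x)"] by blast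
  then interpret encoded_gadget V r par idx D Ref "card {v. vert v}" h \<pi>
    using Ref irr h by unfold_locales auto
  show ?thesis by (rule is_IR_tree)
qed

theorem theorem1:
  fixes Ref :: "nat \<Rightarrow> (nat \<Rightarrow> nat \<Rightarrow> bool) \<Rightarrow> (nat \<Rightarrow> nat) \<Rightarrow> nat list \<Rightarrow> (nat \<Rightarrow> nat)"
    and V :: "'a set" and r :: 'a and par :: "'a \<Rightarrow> 'a"
  assumes "refinement Ref"
    and "rooted_tree V r par"
    and "irreducible_tree V r par"
  shows "is_IR_tree Ref V r par \<longleftrightarrow>
    \<not> (\<exists>u \<in> V. card (children V r par u) = 2 \<and>
              card {c \<in> children V r par u. is_leaf V r par c} = 1)"
proof (intro iffI notI, elim bexE conjE)
  fix u assume "is_IR_tree Ref V r par" "u \<in> V" "card (children V r par u) = 2"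
    "card {c \<in> children V r par u. is_leaf V r par c} = 1"
  then show False using IR_tree_leaf_condition[OF assms(1), of V r par u] by simp
next
  assume "\<not> (\<exists>u \<in> V. card (children V r par u) = 2 \<and>
              card {c \<in> children V r par u. is_leaf V r par c} = 1)"
  then show "is_IR_tree Ref V r par"
    by (intro IR_tree_if_leaf_condition[OF assms]) meson
qed

end
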